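(* Let the data satisfy the standing assumptions (1)-(3) of the context, let $\phi\in C^3(\overline{\mathcal{O}})$ and denote by $\phi|_{\mathcal G_{\Delta x}}$ its restriction to $\mathcal G_{\Delta x}$. Then there exist real numbers $K_{k,i}^s(a,b)$ (for all $\Delta t\in(0,\overline{\Delta t}]$, all meshes of size $\Delta x$, $k\in\mathcal I_{\Delta t}^*$, $i\in\mathcal I_{\Delta x}$, $s\in\mathcal I$, $a\in A$, $b\in B$), such that the set $\{K_{k,i}^s(a,b)\}$ is bounded independently of $(\Delta t,\Delta x)$, and the following hold: (i) For all $k\in\mathcal I_{\Delta t}^*$, $i\in\mathcal I_{\Delta x}$, $a\in A$ and $b\in B$, $$\mathcal S_{k,i}[\phi|_{\mathcal G_{\Delta x}}](a,b)-\phi(x_i)=-\Delta t\,\mathcal H(t_k,x_i,D\phi(x_i),D^2\phi(x_i),a)-\frac1{2N_\sigma}\sum_{s\in\mathcal I}\tilde d_{k,i}^s(a,b)\left(\tilde{\mathcal L}_{k,i}^s(D\phi(x_i),a,b)-\sqrt{\Delta t}\,K_{k,i}^s(a,b)\right)+O\left(\Delta t\sqrt{\Delta t}+(\Delta x)^2\right).$$ (ii) For all $k\in\mathcal I_{\Delta t}^*$ and $i\in\mathcal I_{\Delta x}$, $$S_{k,i}[\phi|_{\mathcal G_{\Delta x}}]-\phi(x_i)=-\sup_{a\in A,\,b\in B}\left\{\Delta t\,\mathcal H(t_k,x_i,D\phi(x_i),D^2\phi(x_i),a)+\frac1{2N_\sigma}\sum_{s\in\mathcal I}\tilde d_{k,i}^s(a,b)\left(\tilde{\mathcal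 L}_{k,i}^s(D\phi(x_i),a,b)-\sqrt{\Delta t}\,K_{k,i}^s(a,b)\right)\right\}+O\left(\Delta t\sqrt{\Delta t}+(\Delta x)^2\right).$$ Here $O(\cdot)$ denotes a quantity bounded in absolute value by a constant times its argument, the constant being independent of $k,i,a,b,\Delta t,\Delta x$.
   Context: **Data and standing assumptions.** $T>0$; $A\subset\mathbb{R}^{N_A}$, $B\subset\mathbb{R}^{N_B}$ are nonempty compact sets; $\mathcal V\subseteq\mathbb{R}^{N_B}$ is open with $B\subset\mathcal V$; $1\le N_\sigma\le N$; $\sigma:[0,T]\times\overline{\mathcal{O}}\times A\to\mathbb{R}^{N\times N_\sigma}$ with columns $\sigma^1,\dots,\sigma^{N_\sigma}$; $\mu:[0,T]\times\overline{\mathcal{O}}\times A\to\mathbb{R}^N$; $f:[0,T]\times\overline{\mathcal{O}}\times A\to\mathbb{R}$; $\gamma:\partial\mathcal{O}\times\mathcal V\to\mathbb{R}^N$, written $\gamma_b(x)=\gamma(x,b)$; $g:[0,T]\times\partial\mathcal{O}\times B\to\mathbb{R}$; $\Psi:\overline{\mathcal{O}}\to\mathbb{R}$. (1) $\mathcal{O}\subseteq\mathbb{R}^N$ ($1\le N\le3$) is a nonempty bounded domain with boundary of class $C^3$; $n(x)$ is the unit outward normal at $x\in\partial\mathcal{O}$. (2) $\sigma,\mu,f,g,\Psi$ are continuous, and $\sigma(\cdot,\cdot,a)$, $\mu(\cdot,\cdot,a)$ are Lipschitz with constants independent of $a\in A$. (3) $\gamma$ is of class $C^1$, and $|\gamma_b(x)|=1$,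 $\langle n(x),\gamma_b(x)\rangle>0$ for all $(x,b)\in\partial\mathcal{O}\times B$. **Meshes and interpolation.** For each mesh size $\Delta x>0$ under consideration (ranging over a set of positive numbers accumulating at $0$), a polyhedral domain $\mathcal{O}_{\Delta x}\subseteq\mathbb{R}^N$ is given with a triangulation $\mathbb{T}_{\Delta x}$ into simplices $\mathsf T$ with vertex set $\mathcal G_{\Delta x}=\{x_i: i\in\mathcal I_{\Delta x}\}$, $\mathcal I_{\Delta x}=\{1,\dots,N_{\Delta x}\}$, such that: $\Delta x$ is the maximum of the diameters of the simplices; all vertices on $\partial\mathcal{O}_{\Delta x}$ lie on $\partial\mathcal{O}$; at most one face of each element with vertices on $\partial\mathcal{O}_{\Delta x}$ intersects $\partial\mathcal{O}_{\Delta x}$; there is $\delta\in(0,1)$ independent of $\Delta x$ such that each $\mathsf T$ is contained in a ball of radius $\Delta x/\delta$ and contains a ball of radius $\delta\Delta x$. There is also an exact triangulation $\widehat{\mathbb{T}}_{\Delta x}$ of $\overline{\mathcal{O}}$, $\overline{\mathcal{O}}=\bigcup\widehat{\mathsf T}$, with vertices in $\mathcal G_{\Delta x}$, whose elements correspond one-to-one to those of $\mathbb{T}_{\Delta x}$ with the same vertices; only boundary elements may be curved. The map $p_{\Delta x}:\overline{\mathcal{O}}\to\overline{\mathcal{O}}_{\Delta x}\cap\overline{\mathcal{O}}$ is $p_{\Delta x}(x)=p_{\mathsf T}(x)$ for $x\in\widehat{\mathsf T}$, where $\mathsf T$ has the same vertices as $\widehat{\mathsf T}$ and $p_{\mathsf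 T}$ is the projection onto $\mathsf T$. The domains approximate $\mathcal{O}$ to second order: there is $C>0$ independent of $\Delta x$ with $|x-p_{\Delta x}(x)|\le C(\Delta x)^2$ for all $x\in\overline{\mathcal{O}}$. Let $\psi_i$ be the $\mathbb{P}_1$ basis functions on $\mathbb{T}_{\Delta x}$ (continuous, affine on each $\mathsf T$, $\psi_i(x_j)=\delta_{ij}$). For $\phi:\mathcal G_{\Delta x}\to\mathbb{R}$, $I[\phi](x)=\sum_{i\in\mathcal I_{\Delta x}}\psi_i(p_{\Delta x}(x))\phi(x_i)$, $x\in\overline{\mathcal{O}}$. **Scheme operators.** For $\Delta t>0$: $N_{\Delta t}=\lfloor T/\Delta t\rfloor$, $t_k=k\Delta t$, $\mathcal I_{\Delta t}^*=\{0,\dots,N_{\Delta t}-1\}$. For $\ell=1,\dots,N_\sigma$, $y_{k,i}^{\pm,\ell}(a)=x_i+\Delta t\,\mu(t_k,x_i,a)\pm\sqrt{N_\sigma\Delta t}\,\sigma^\ell(t_k,x_i,a)$; $\mathcal I=\{+,-\}\times\{1,\dots,N_\sigma\}$; $\bar c>0$ is a fixed constant. For some (small) $R>0$ there are uniquely determined $C^1$ functions $(x,b)\mapsto p^{\gamma_b}(x)\in\partial\mathcal{O}$ and $(x,b)\mapsto d^{\gamma_b}(x)\in\mathbb{R}$ on $\{x: d(x,\partial\mathcal{O})<R\}\times B$ with $x=p^{\gamma_b}(x)+d^{\gamma_b}(x)\gamma_b(p^{\gamma_b}(x))$ and $d^{\gamma_b}=0$ on $\partial\mathcal{O}$. There is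 $\overline{\Delta t}>0$ such that for all $\Delta t\in(0,\overline{\Delta t}]$ the following is well defined, for $k\in\mathcal I_{\Delta t}^*$, $i\in\mathcal I_{\Delta x}$, $a\in A$, $b\in B$, $s\in\mathcal I$: if $y_{k,i}^s(a)\in\overline{\mathcal{O}}$, then $\tilde y_{k,i}^s(a,b)=y_{k,i}^s(a)$, $\tilde d_{k,i}^s(a,b)=0$, $\tilde g_{k,i}^s(a,b)=0$; otherwise, with $y=y_{k,i}^s(a)$, $\tilde y_{k,i}^s(a,b)=p^{\gamma_b}(y)-\bar c\sqrt{\Delta t}\,\gamma_b(p^{\gamma_b}(y))\in\overline{\mathcal{O}}$, $\tilde d_{k,i}^s(a,b)=d^{\gamma_b}(y)+\bar c\sqrt{\Delta t}$, $\tilde g_{k,i}^s(a,b)=g(t_k,p^{\gamma_b}(y),b)$. For $\Phi:\mathcal G_{\Delta x}\to\mathbb{R}$, $$\mathcal S_{k,i}[\Phi](a,b)=\frac1{2N_\sigma}\sum_{s\in\mathcal I}\left[I[\Phi](\tilde y_{k,i}^s(a,b))+\tilde d_{k,i}^s(a,b)\tilde g_{k,i}^s(a,b)\right]+\Delta t\,f(t_k,x_i,a),\qquad S_{k,i}[\Phi]=\inf_{a\in A,\,b\in B}\mathcal S_{k,i}[\Phi](a,b).$$ **Continuous operators.** $\mathcal H(t,x,p,M,a)=-\frac12\operatorname{Tr}(\sigma(t,x,a)\sigma(t,x,a)^\top M)-\langle\mu(t,x,a),p\rangle-f(t,x,a)$ for $M\in\mathbb{R}^{N\times N}$; $\mathcal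 L(t,x,p,b)=\langle\gamma_b(x),p\rangle-g(t,x,b)$ for $x\in\partial\mathcal{O}$; and, for $q\in\mathbb{R}^N$, $\tilde{\mathcal L}_{k,i}^s(q,a,b)=0$ if $y_{k,i}^s(a)\in\overline{\mathcal{O}}$ and $\tilde{\mathcal L}_{k,i}^s(q,a,b)=\mathcal L(t_k,p^{\gamma_b}(y_{k,i}^s(a)),q,b)$ otherwise. *)

theory Defs
  imports "HOL-Analysis.Analysis"
begin

section \<open>Functions of class \<open>C\<^sup>k\<close>\<close>

text \<open>\<open>Ck_on\<close> is meant for open sets: all iterated directional derivatives of order at most \<open>k\<close>
  exist and are continuous.\<close>

primrec Ck_on :: "nat \<Rightarrow> ('a::euclidean_space \<Rightarrow> 'b::real_normed_vector) \<Rightarrow> 'a set \<Rightarrow> bool" where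
  "Ck_on 0 f U \<longleftrightarrow> continuous_on U f"
| "Ck_on (Suc k) f U \<longleftrightarrow>
     (\<forall>x\<in>U. f differentiable (at x)) \<and> (\<forall>v. Ck_on k (\<lambda>x. frechet_derivative f (at x) v) U)"

text \<open>Class \<open>C\<^sup>k\<close> on an arbitrary set, e.g. on a submanifold or on a product with a compact set:
  locally the restriction of a \<open>C\<^sup>k\<close> function on an open set of the ambient space.\<close>

definition Ck_on_set ::
  "nat \<Rightarrow> ('a::euclidean_space \<Rightarrow> 'b::real_normed_vector) \<Rightarrow> 'a set \<Rightarrow> bool" where
  "Ck_on_set k f S \<longleftrightarrow>
     (\<forall>z\<in>S. \<exists>U f'. open U \<and> z \<in> U \<and> Ck_on k f' U \<and> (\<forall>y\<in>S \<inter> U. f' y = f y))"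

text \<open>\<open>f \<in> C\<^sup>k(closure \<Omega>)\<close> for an open set \<open>\<Omega>\<close>: every derivative of \<open>f\<close> in \<open>\<Omega>\<close> of order at most \<open>k\<close>
  has a continuous extension to \<open>closure \<Omega>\<close>. The function \<open>g\<close> below is such an extension.\<close>

primrec Ck_closure ::
  "nat \<Rightarrow> ('a::euclidean_space \<Rightarrow> 'b::real_normed_vector) \<Rightarrow> 'a set \<Rightarrow> bool" where
  "Ck_closure 0 f \<Omega> \<longleftrightarrow> continuous_on (closure \<Omega>) f"
| "Ck_closure (Suc k) f \<Omega> \<longleftrightarrow>
     continuous_on (closure \<Omega>) f \<and> (\<forall>x\<in>\<Omega>. f differentiable (at x)) \<and>
     (\<forall>v. \<exists>g. (\<forall>x\<in>\<Omega>. g x = frechet_derivative f (at x) v) \<and> Ck_closure k g \<Omega>)"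

text \<open>The gradient and the Hessian on \<open>closure \<Omega>\<close>; on the boundary these are the continuous extensions
  of the derivatives in \<open>\<Omega>\<close>, so that \<open>G\<close> and \<open>H\<close> are determined by \<open>\<phi>\<close> on \<open>closure \<Omega>\<close>.\<close>

definition gradient_on_closure ::
  "(real^'n) set \<Rightarrow> (real^'n \<Rightarrow> real) \<Rightarrow> (real^'n \<Rightarrow> real^'n) \<Rightarrow> bool" where
  "gradient_on_closure \<Omega> \<phi> G \<longleftrightarrow>
     continuous_on (closure \<Omega>) G \<and> (\<forall>x\<in>\<Omega>. (\<phi> has_derivative (\<lambda>h. G x \<bullet> h)) (at x))"

definition hessian_on_closure ::
  "(real^'n) set \<Rightarrow> (real^'n \<Rightarrow> real) \<Rightarrow> (real^'n \<Rightarrow> real^'n^'n) \<Rightarrow> bool" where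
  "hessian_on_closure \<Omega> \<phi> H \<longleftrightarrow>
     continuous_on (closure \<Omega>) H \<and>
     (\<exists>G. gradient_on_closure \<Omega> \<phi> G \<and> (\<forall>x\<in>\<Omega>. (G has_derivative (\<lambda>h. H x *v h)) (at x)))"

section \<open>Domains and their boundaries\<close>

text \<open>Boundary of class \<open>C\<^sup>k\<close>: near each boundary point a \<open>C\<^sup>k\<close> diffeomorphism straightens the
  boundary, with the set on one side of it.\<close>

definition Ck_boundary :: "nat \<Rightarrow> ('a::euclidean_space) set \<Rightarrow> bool" where
  "Ck_boundary k \<Omega> \<longleftrightarrow>
     (\<forall>z\<in>frontier \<Omega>. \<exists>U W F F' e.
        open U \<and> z \<in> U \<and> open (W :: 'a set) \<and> homeomorphism U W F F' \<and> Ck_on k F U \<and> Ck_on k F' W \<and>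
        norm e = 1 \<and>
        F ` (U \<inter> \<Omega>) = W \<inter> {y. 0 < e \<bullet> y} \<and>
        F ` (U \<inter> frontier \<Omega>) = W \<inter> {y. e \<bullet> y = 0})"

text \<open>Orthogonality to the boundary is orthogonality to the velocities of curves in the boundary;
  in dimension one this is no restriction.\<close>

definition outward_unit_normal :: "('a::euclidean_space) set \<Rightarrow> 'a \<Rightarrow> 'a \<Rightarrow> bool" where
  "outward_unit_normal \<Omega> x n \<longleftrightarrow>
     norm n = 1 \<and>
     (\<forall>c v. c (0::real) = x \<and> (\<forall>t. c t \<in> frontier \<Omega>) \<and> (c has_vector_derivative v) (at 0)
        \<longrightarrow> n \<bullet> v = 0) \<and>
     (\<exists>\<epsilon>>0. \<forall>t. 0 < t \<and> t < \<epsilon> \<longrightarrow> x - t *\<^sub>R n \<in> \<Omega> \<and> x + t *\<^sub>R n \<notin> closure \<Omega>)"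

definition polyhedral_domain :: "('a::euclidean_space) set \<Rightarrow> bool" where
  "polyhedral_domain D \<longleftrightarrow> connected D \<and> D \<noteq> {} \<and>
     (\<exists>P. finite P \<and> (\<forall>p\<in>P. polytope p) \<and> D = interior (\<Union>P))"

section \<open>The data\<close>

text \<open>The dimensions \<open>N\<close>, \<open>N\<^sub>A\<close>, \<open>N\<^sub>B\<close>, \<open>N\<^sub>\<sigma>\<close> are the cardinalities of the index types
  \<open>'n\<close>, \<open>'na\<close>, \<open>'nb\<close>, \<open>'s\<close>. All functions are total; only their values on the domains
  named in \<open>standing_assumptions\<close> and \<open>oblique_projection\<close> matter.\<close>

record ('n, 'na, 'nb, 's) problem =
  horizon :: real
  region :: "(real^'n) set"
  nrm :: "real^'n \<Rightarrow> real^'n"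
  ctrlA :: "(real^'na) set"
  ctrlB :: "(real^'nb) set"
  nbhdB :: "(real^'nb) set"
  sig :: "real \<Rightarrow> real^'n \<Rightarrow> real^'na \<Rightarrow> real^'s^'n"
  mu :: "real \<Rightarrow> real^'n \<Rightarrow> real^'na \<Rightarrow> real^'n"
  runcost :: "real \<Rightarrow> real^'n \<Rightarrow> real^'na \<Rightarrow> real"
  gam :: "real^'nb \<Rightarrow> real^'n \<Rightarrow> real^'n"
  bdcost :: "real \<Rightarrow> real^'n \<Rightarrow> real^'nb \<Rightarrow> real"
  termcost :: "real^'n \<Rightarrow> real"
  cbar :: real
  tubeR :: real
  pgam :: "real^'nb \<Rightarrow> real^'n \<Rightarrow> real^'n"
  dgam :: "real^'nb \<Rightarrow> real^'n \<Rightarrow> real"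

definition standing_assumptions ::
  "('n::finite, 'na::finite, 'nb::finite, 's::finite) problem \<Rightarrow> bool" where
  "standing_assumptions P \<longleftrightarrow>
     horizon P > 0 \<and>
     ctrlA P \<noteq> {} \<and> compact (ctrlA P) \<and> ctrlB P \<noteq> {} \<and> compact (ctrlB P) \<and>
     open (nbhdB P) \<and> ctrlB P \<subseteq> nbhdB P \<and>
     CARD('s) \<le> CARD('n) \<and> CARD('n) \<le> 3 \<and>
     region P \<noteq> {} \<and> open (region P) \<and> connected (region P) \<and> bounded (region P) \<and> Ck_boundary 3 (region P) \<and>
     (\<forall>x\<in>frontier (region P). outward_unit_normal (region P) x (nrm P x)) \<and>
     continuous_on ({0..horizon P} \<times> closure (region P) \<times> ctrlA P) (\<lambda>(t, x, a). sig P t x a) \<and>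
     continuous_on ({0..horizon P} \<times> closure (region P) \<times> ctrlA P) (\<lambda>(t, x, a). mu P t x a) \<and>
     continuous_on ({0..horizon P} \<times> closure (region P) \<times> ctrlA P) (\<lambda>(t, x, a). runcost P t x a) \<and>
     continuous_on ({0..horizon P} \<times> frontier (region P) \<times> ctrlB P) (\<lambda>(t, x, b). bdcost P t x b) \<and>
     continuous_on (closure (region P)) (termcost P) \<and>
     (\<exists>L. \<forall>a\<in>ctrlA P. L-lipschitz_on ({0..horizon P} \<times> closure (region P)) (\<lambda>(t, x). sig P t x a)) \<and>
     (\<exists>L. \<forall>a\<in>ctrlA P. L-lipschitz_on ({0..horizon P} \<times> closure (region P)) (\<lambda>(t, x). mu P t x a)) \<and>
     Ck_on_set 1 (\<lambda>(x, b). gam P b x) (frontier (region P) \<times> nbhdB P) \<and>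
     (\<forall>x\<in>frontier (region P). \<forall>b\<in>ctrlB P. norm (gam P b x) = 1 \<and> nrm P x \<bullet> gam P b x > 0)"

definition oblique_projection ::
  "('n::finite, 'na::finite, 'nb::finite, 's::finite) problem \<Rightarrow> real \<Rightarrow>
   (real^'nb \<Rightarrow> real^'n \<Rightarrow> real^'n) \<Rightarrow> (real^'nb \<Rightarrow> real^'n \<Rightarrow> real) \<Rightarrow> bool" where
  "oblique_projection P R p d \<longleftrightarrow>
     (let S = {x. infdist x (frontier (region P)) < R} in
        Ck_on_set 1 (\<lambda>(x, b). p b x) (S \<times> ctrlB P) \<and>
        Ck_on_set 1 (\<lambda>(x, b). d b x) (S \<times> ctrlB P) \<and>
        (\<forall>x\<in>S. \<forall>b\<in>ctrlB P. p b x \<in> frontier (region P) \<and> x = p b x + d b x *\<^sub>R gam P b (p b x)) \<and>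
        (\<forall>x\<in>frontier (region P). \<forall>b\<in>ctrlB P. d b x = 0))"

definition oblique_projection_unique ::
  "('n::finite, 'na::finite, 'nb::finite, 's::finite) problem \<Rightarrow> bool" where
  "oblique_projection_unique P \<longleftrightarrow>
     tubeR P > 0 \<and> oblique_projection P (tubeR P) (pgam P) (dgam P) \<and>
     (\<forall>p d. oblique_projection P (tubeR P) p d \<longrightarrow>
        (\<forall>x b. infdist x (frontier (region P)) < tubeR P \<and> b \<in> ctrlB P \<longrightarrow>
           p b x = pgam P b x \<and> d b x = dgam P b x))"

section \<open>Meshes and interpolation\<close>

text \<open>\<open>curved m T\<close> is the element of the exact triangulation that corresponds to the simplex \<open>T\<close>.\<close>

record 'n mesh =
  polydom :: "(real^'n) set"
  elems :: "(real^'n) set set"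
  nverts :: nat
  vert :: "nat \<Rightarrow> real^'n"
  curved :: "(real^'n) set \<Rightarrow> (real^'n) set"
  meshproj :: "real^'n \<Rightarrow> real^'n"
  p1basis :: "nat \<Rightarrow> real^'n \<Rightarrow> real"

definition indices :: "('n::finite) mesh \<Rightarrow> nat set" where
  "indices m = {1..nverts m}"

definition vertices :: "('n::finite) mesh \<Rightarrow> (real^'n) set" where
  "vertices m = {v. \<exists>T\<in>elems m. v extreme_point_of T}"

text \<open>In \<open>triangulated\<close>, a face of an element is counted as a boundary face if it is contained in the
  boundary of the polyhedral domain: the other faces of a boundary element share vertices with the
  boundary, so mere intersection cannot be meant.\<close>

definition triangulated ::
  "(real^'n::finite) set \<Rightarrow> real \<Rightarrow> real \<Rightarrow> 'n mesh \<Rightarrow> bool" where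
  "triangulated \<Omega> \<delta> \<Delta>x m \<longleftrightarrow>
     polyhedral_domain (polydom m) \<and>
     triangulation (elems m) \<and> (\<forall>T\<in>elems m. int CARD('n) simplex T) \<and>
     \<Union>(elems m) = closure (polydom m) \<and>
     bij_betw (vert m) (indices m) (vertices m) \<and>
     \<Delta>x = Max (diameter ` elems m) \<and>
     (\<forall>v\<in>vertices m. v \<in> frontier (polydom m) \<longrightarrow> v \<in> frontier \<Omega>) \<and>
     (\<forall>T\<in>elems m. \<forall>F F'. F facet_of T \<and> F' facet_of T \<and>
        F \<subseteq> frontier (polydom m) \<and> F' \<subseteq> frontier (polydom m) \<longrightarrow> F = F') \<and>
     (\<forall>T\<in>elems m. (\<exists>c. T \<subseteq> cball c (\<Delta>x / \<delta>)) \<and> (\<exists>c. cball c (\<delta> * \<Delta>x) \<subseteq> T))"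

text \<open>A curved element with the vertices of \<open>T\<close> is a homeomorphic image of \<open>T\<close> under a map that fixes
  the vertices, its curved faces being the images of the faces of \<open>T\<close>. As in the straight case,
  two elements meet in the curved face spanned by their common vertices.\<close>

definition exactly_triangulated :: "(real^'n::finite) set \<Rightarrow> 'n mesh \<Rightarrow> bool" where
  "exactly_triangulated \<Omega> m \<longleftrightarrow>
     inj_on (curved m) (elems m) \<and>
     \<Union>(curved m ` elems m) = closure \<Omega> \<and>
     (\<exists>F. (\<forall>T\<in>elems m. (\<exists>F'. homeomorphism T (curved m T) (F T) F') \<and>
             (\<forall>v. v extreme_point_of T \<longrightarrow> F T v = v)) \<and>
          (\<forall>T\<in>elems m. \<forall>T'\<in>elems m. curved m T \<inter> curved m T' = F T ` (T \<inter> T'))) \<and>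
     (\<forall>T\<in>elems m. curved m T \<noteq> T \<longrightarrow> (\<exists>v. v extreme_point_of T \<and> v \<in> frontier (polydom m)))"

text \<open>If \<open>x\<close> lies in several curved elements, the projection onto any of the corresponding simplices
  is admitted.\<close>

definition mesh_projection :: "(real^'n::finite) set \<Rightarrow> 'n mesh \<Rightarrow> bool" where
  "mesh_projection \<Omega> m \<longleftrightarrow>
     (\<forall>x\<in>closure \<Omega>. (\<exists>T\<in>elems m. x \<in> curved m T \<and> meshproj m x = closest_point T x) \<and>
        meshproj m x \<in> closure (polydom m) \<inter> closure \<Omega>)"

definition is_p1basis :: "('n::finite) mesh \<Rightarrow> bool" where
  "is_p1basis m \<longleftrightarrow>
     (\<forall>i\<in>indices m.
        continuous_on (closure (polydom m)) (p1basis m i) \<and>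
        (\<forall>T\<in>elems m. \<exists>c v. \<forall>x\<in>T. p1basis m i x = c + v \<bullet> x) \<and>
        (\<forall>j\<in>indices m. p1basis m i (vert m j) = (if i = j then 1 else 0)))"

definition mesh_family ::
  "(real^'n::finite) set \<Rightarrow> real set \<Rightarrow> (real \<Rightarrow> 'n mesh) \<Rightarrow> bool" where
  "mesh_family \<Omega> sizes mesh \<longleftrightarrow>
     sizes \<subseteq> {0<..} \<and> 0 islimpt sizes \<and>
     (\<exists>\<delta>. 0 < \<delta> \<and> \<delta> < 1 \<and> (\<forall>\<Delta>x\<in>sizes. triangulated \<Omega> \<delta> \<Delta>x (mesh \<Delta>x))) \<and>
     (\<forall>\<Delta>x\<in>sizes. exactly_triangulated \<Omega> (mesh \<Delta>x) \<and> mesh_projection \<Omega> (mesh \<Delta>x) \<and>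
        is_p1basis (mesh \<Delta>x)) \<and>
     (\<exists>C>0. \<forall>\<Delta>x\<in>sizes. \<forall>x\<in>closure \<Omega>. norm (x - meshproj (mesh \<Delta>x) x) \<le> C * \<Delta>x\<^sup>2)"

definition interp :: "('n::finite) mesh \<Rightarrow> (real^'n \<Rightarrow> real) \<Rightarrow> real^'n \<Rightarrow> real" where
  "interp m \<Phi> x = (\<Sum>i\<in>indices m. p1basis m i (meshproj m x) * \<Phi> (vert m i))"

section \<open>The scheme\<close>

definition num_steps :: "('n::finite, 'na::finite, 'nb::finite, 's::finite) problem \<Rightarrow> real \<Rightarrow> nat" where
  "num_steps P \<Delta>t = nat \<lfloor>horizon P / \<Delta>t\<rfloor>"

definition tm :: "real \<Rightarrow> nat \<Rightarrow> real" where
  "tm \<Delta>t k = real k * \<Delta>t"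

text \<open>The index set \<open>{+, -} \<times> {1, \<dots>, N\<^sub>\<sigma>}\<close> is the type \<open>bool \<times> 's\<close>, with \<open>True\<close> for \<open>+\<close>.\<close>

definition ypt ::
  "('n::finite, 'na::finite, 'nb::finite, 's::finite) problem \<Rightarrow> 'n mesh \<Rightarrow> real \<Rightarrow>
   nat \<Rightarrow> nat \<Rightarrow> bool \<times> 's \<Rightarrow> real^'na \<Rightarrow> real^'n" where
  "ypt P m \<Delta>t k i s a =
     vert m i + \<Delta>t *\<^sub>R mu P (tm \<Delta>t k) (vert m i) a
       + ((if fst s then 1 else - 1) * sqrt (real CARD('s) * \<Delta>t))
           *\<^sub>R column (snd s) (sig P (tm \<Delta>t k) (vert m i) a)"

definition reflected ::
  "('n::finite, 'na::finite, 'nb::finite, 's::finite) problem \<Rightarrow> real \<Rightarrow>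
   real^'n \<Rightarrow> real^'nb \<Rightarrow> real^'n" where
  "reflected P \<Delta>t y b = pgam P b y - (cbar P * sqrt \<Delta>t) *\<^sub>R gam P b (pgam P b y)"

definition ytil ::
  "('n::finite, 'na::finite, 'nb::finite, 's::finite) problem \<Rightarrow> 'n mesh \<Rightarrow> real \<Rightarrow>
   nat \<Rightarrow> nat \<Rightarrow> bool \<times> 's \<Rightarrow> real^'na \<Rightarrow> real^'nb \<Rightarrow> real^'n" where
  "ytil P m \<Delta>t k i s a b =
     (let y = ypt P m \<Delta>t k i s a in
      if y \<in> closure (region P) then y else reflected P \<Delta>t y b)"

definition dtil ::
  "('n::finite, 'na::finite, 'nb::finite, 's::finite) problem \<Rightarrow> 'n mesh \<Rightarrow> real \<Rightarrow>
   nat \<Rightarrow> nat \<Rightarrow> bool \<times> 's \<Rightarrow> real^'na \<Rightarrow> real^'nb \<Rightarrow> real" where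
  "dtil P m \<Delta>t k i s a b =
     (let y = ypt P m \<Delta>t k i s a in
      if y \<in> closure (region P) then 0 else dgam P b y + cbar P * sqrt \<Delta>t)"

definition gtil ::
  "('n::finite, 'na::finite, 'nb::finite, 's::finite) problem \<Rightarrow> 'n mesh \<Rightarrow> real \<Rightarrow>
   nat \<Rightarrow> nat \<Rightarrow> bool \<times> 's \<Rightarrow> real^'na \<Rightarrow> real^'nb \<Rightarrow> real" where
  "gtil P m \<Delta>t k i s a b =
     (let y = ypt P m \<Delta>t k i s a in
      if y \<in> closure (region P) then 0 else bdcost P (tm \<Delta>t k) (pgam P b y) b)"

definition well_defined_up_to ::
  "('n::finite, 'na::finite, 'nb::finite, 's::finite) problem \<Rightarrow> real set \<Rightarrow>
   (real \<Rightarrow> 'n mesh) \<Rightarrow> real \<Rightarrow> bool" where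
  "well_defined_up_to P sizes mesh \<Delta>tbar \<longleftrightarrow>
     (\<forall>\<Delta>t \<Delta>x k i s a b.
        0 < \<Delta>t \<and> \<Delta>t \<le> \<Delta>tbar \<and> \<Delta>x \<in> sizes \<and> k < num_steps P \<Delta>t \<and> i \<in> indices (mesh \<Delta>x) \<and>
        a \<in> ctrlA P \<and> b \<in> ctrlB P \<and> ypt P (mesh \<Delta>x) \<Delta>t k i s a \<notin> closure (region P) \<longrightarrow>
        infdist (ypt P (mesh \<Delta>x) \<Delta>t k i s a) (frontier (region P)) < tubeR P \<and>
        reflected P \<Delta>t (ypt P (mesh \<Delta>x) \<Delta>t k i s a) b \<in> closure (region P))"

definition scheme_ab ::
  "('n::finite, 'na::finite, 'nb::finite, 's::finite) problem \<Rightarrow> 'n mesh \<Rightarrow> real \<Rightarrow>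
   nat \<Rightarrow> nat \<Rightarrow> (real^'n \<Rightarrow> real) \<Rightarrow> real^'na \<Rightarrow> real^'nb \<Rightarrow> real" where
  "scheme_ab P m \<Delta>t k i \<Phi> a b =
     1 / (2 * real CARD('s)) *
       (\<Sum>s\<in>UNIV. interp m \<Phi> (ytil P m \<Delta>t k i s a b) + dtil P m \<Delta>t k i s a b * gtil P m \<Delta>t k i s a b)
     + \<Delta>t * runcost P (tm \<Delta>t k) (vert m i) a"

definition scheme ::
  "('n::finite, 'na::finite, 'nb::finite, 's::finite) problem \<Rightarrow> 'n mesh \<Rightarrow> real \<Rightarrow>
   nat \<Rightarrow> nat \<Rightarrow> (real^'n \<Rightarrow> real) \<Rightarrow> real" where
  "scheme P m \<Delta>t k i \<Phi> = (INF (a, b)\<in>ctrlA P \<times> ctrlB P. scheme_ab P m \<Delta>t k i \<Phi> a b)"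

section \<open>The continuous operators\<close>

definition Hop ::
  "('n::finite, 'na::finite, 'nb::finite, 's::finite) problem \<Rightarrow> real \<Rightarrow> real^'n \<Rightarrow>
   real^'n \<Rightarrow> real^'n^'n \<Rightarrow> real^'na \<Rightarrow> real" where
  "Hop P t x p M a =
     - (1 / 2) * trace (sig P t x a ** transpose (sig P t x a) ** M) - mu P t x a \<bullet> p
       - runcost P t x a"

definition Lop ::
  "('n::finite, 'na::finite, 'nb::finite, 's::finite) problem \<Rightarrow> real \<Rightarrow> real^'n \<Rightarrow>
   real^'n \<Rightarrow> real^'nb \<Rightarrow> real" where
  "Lop P t x p b = gam P b x \<bullet> p - bdcost P t x b"

definition Ltil ::
  "('n::finite, 'na::finite, 'nb::finite, 's::finite) problem \<Rightarrow> 'n mesh \<Rightarrow> real \<Rightarrow>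
   nat \<Rightarrow> nat \<Rightarrow> bool \<times> 's \<Rightarrow> real^'n \<Rightarrow> real^'na \<Rightarrow> real^'nb \<Rightarrow> real" where
  "Ltil P m \<Delta>t k i s q a b =
     (let y = ypt P m \<Delta>t k i s a in
      if y \<in> closure (region P) then 0 else Lop P (tm \<Delta>t k) (pgam P b y) q b)"

end

theory Submission
  imports Defs
begin

text \<open>The scheme averages the interpolant of \<open>\<phi>\<close> over the end points of a symmetric random walk with steps of
  order \<open>sqrt \<Delta>t\<close>, reflected into the domain along \<open>gam\<close> where they leave it. Consistency is a Taylor
  expansion of \<open>\<phi>\<close> at the vertex \<open>x\<close> up to second order, in which three points need an argument.

  First, the segment from \<open>x\<close> to an end point may leave the domain, where \<open>\<phi>\<close> is arbitrary, and \<open>x\<close> may lie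
  on the boundary. The cubic bound on the Taylor remainder nevertheless holds on the closure
  (\<open>taylor_on_closure\<close>): boundary charts provide curves in the domain whose length is comparable to the
  distance of their end points, the bound on the third derivatives is integrated along them, and
  continuity and compactness do the rest. The same expansion at the projection of a point onto the
  mesh shows that interpolation costs \<open>O(\<Delta>x\<^sup>2)\<close> (\<open>interp_error\<close>), as barycentric averaging cancels the
  linear term.

  Secondly, a reflected end point is \<open>x + h - d *\<^sub>R v\<close>, where \<open>h\<close> is the step of the walk, \<open>v\<close> a unit
  vector and \<open>d\<close> the value of \<open>dtil\<close>. The linear term \<open>- d * (D\<phi> x \<bullet> v)\<close> and the boundary cost form the
  boundary operator. The remaining terms with the factor \<open>d\<close> come from the Hessian; their cofactor,
  divided by \<open>sqrt \<Delta>t\<close>, is taken as the correction \<open>K\<close> (\<open>boundary_correction\<close>). It is bounded because \<open>d\<close>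
  is of order \<open>sqrt \<Delta>t\<close>: the oblique distance is Lipschitz and vanishes on the boundary, which the segment
  from \<open>x\<close> to an exterior point crosses (\<open>oblique_distance_bound\<close>). Thus a single summand of the scheme is
  expanded with error \<open>O(\<Delta>t * sqrt \<Delta>t + \<Delta>x\<^sup>2)\<close> (\<open>scheme_summand_expansion\<close>).

  Thirdly, in the average over the walk the terms without the factor \<open>d\<close> give the generator in \<open>Hop\<close>
  up to \<open>O(\<Delta>t\<^sup>2)\<close> (\<open>symmetric_walk_second_order_sum\<close>), which proves the pointwise expansion. The errors are
  uniform in the controls, so the expansion of the infimum follows (\<open>INF_plus_SUP_error\<close>).\<close>

section \<open>Mean value estimates\<close>

text \<open>Estimates between two points of a nonconvex domain are obtained along a curve joining them, so the
  mean value inequality is needed for curves rather than for segments.\<close>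

lemma curve_mean_value:
  fixes f :: "'a::real_normed_vector \<Rightarrow> 'b::real_normed_vector" and c :: "real \<Rightarrow> 'a"
  assumes c: "\<And>t. t \<in> {0..1} \<Longrightarrow> (c has_vector_derivative c' t) (at t within {0..1})"
    and L: "\<And>t. t \<in> {0..1} \<Longrightarrow> norm (c' t) \<le> L"
    and f: "\<And>t. t \<in> {0..1} \<Longrightarrow> (f has_derivative f' (c t)) (at (c t))"
    and B: "\<And>t v. t \<in> {0..1} \<Longrightarrow> norm (f' (c t) v) \<le> B * norm v"
    and "0 \<le> B" and s: "s \<in> {0..1}"
  shows "norm (f (c s) - f (c 0)) \<le> B * L"
proof -
  have L0: "0 \<le> L" using order_trans[OF norm_ge_zero L[of 0]] by simp
  have "norm ((f \<circ> c) s - (f \<circ> c) 0) \<le> B * L * norm (s - 0)"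
  proof (rule differentiable_bound[of "{0..1::real}"])
    fix t :: real assume t: "t \<in> {0..1}"
    show "((f \<circ> c) has_derivative (f' (c t) \<circ> (\<lambda>h. h *\<^sub>R c' t))) (at t within {0..1})"
      using c[OF t] f[OF t] unfolding has_vector_derivative_def
      by (meson diff_chain_within has_derivative_at_withinI)
    show "onorm (f' (c t) \<circ> (\<lambda>h. h *\<^sub>R c' t)) \<le> B * L"
    proof (rule onorm_le)
      fix h :: real
      have "norm ((f' (c t) \<circ> (\<lambda>h. h *\<^sub>R c' t)) h) \<le> B * norm (h *\<^sub>R c' t)"
        using B[OF t, of "h *\<^sub>R c' t"] by (simp only: o_def)
      also have "\<dots> = B * norm (c' t) * norm h" by simp
      also have "\<dots> \<le> B * L * norm h"
        using L[OF t] \<open>0 \<le> B\<close> by (intro mult_right_mono mult_left_mono) auto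
      finally show "norm ((f' (c t) \<circ> (\<lambda>h. h *\<^sub>R c' t)) h) \<le> B * L * norm h" .
    qed
  qed (use s in auto)
  also have "\<dots> \<le> B * L * 1"
    using s \<open>0 \<le> B\<close> L0 by (intro mult_left_mono) auto
  finally show ?thesis by simp
qed

lemma Ck_on_imp_continuous_on: "Ck_on k f U \<Longrightarrow> continuous_on U f"
  by (cases k) (auto intro!: continuous_at_imp_continuous_on differentiable_imp_continuous_within)

lemma linear_bound_from_Basis:
  fixes f :: "'a::euclidean_space \<Rightarrow> 'b::real_normed_vector"
  assumes "linear f" and B: "\<And>b. b \<in> Basis \<Longrightarrow> norm (f b) \<le> B"
  shows "norm (f v) \<le> real DIM('a) * B * norm v"
proof -
  have "f v = f (\<Sum>b\<in>Basis. (v \<bullet> b) *\<^sub>R b)" by (simp add: euclidean_representation)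
  also have "\<dots> = (\<Sum>b\<in>Basis. (v \<bullet> b) *\<^sub>R f b)"
    using \<open>linear f\<close> by (simp add: linear_sum linear_scale)
  finally have "norm (f v) \<le> (\<Sum>b\<in>Basis. norm ((v \<bullet> b) *\<^sub>R f b))"
    by (simp only: norm_sum)
  also have "\<dots> \<le> (\<Sum>b\<in>(Basis::'a set). norm v * B)"
    using B by (intro sum_mono) (auto intro!: mult_mono Basis_le_norm)
  also have "\<dots> = real DIM('a) * B * norm v" by simp
  finally show ?thesis .
qed

lemma Ck_on_bounded_derivative:
  fixes f :: "'a::euclidean_space \<Rightarrow> 'b::real_normed_vector"
  assumes f: "Ck_on (Suc k) f U" and K: "compact K" "K \<subseteq> U"
  obtains B where "0 \<le> B"
    and "\<And>x v. x \<in> K \<Longrightarrow> norm (frechet_derivative f (at x) v) \<le> B * norm v"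
proof -
  have "\<exists>M. \<forall>x\<in>K. norm (frechet_derivative f (at x) v) \<le> M" for v
  proof -
    have "Ck_on k (\<lambda>x. frechet_derivative f (at x) v) U" using f by simp
    then have "continuous_on K (\<lambda>x. frechet_derivative f (at x) v)"
      using K Ck_on_imp_continuous_on continuous_on_subset by blast
    then have "bounded ((\<lambda>x. frechet_derivative f (at x) v) ` K)"
      using K compact_continuous_image compact_imp_bounded by blast
    then show ?thesis by (auto simp: bounded_iff)
  qed
  then obtain M where M: "\<And>v x. x \<in> K \<Longrightarrow> norm (frechet_derivative f (at x) v) \<le> M v"
    by metis
  let ?B = "\<Sum>b\<in>Basis. \<bar>M b\<bar>"
  have Mb: "norm (frechet_derivative f (at x) b) \<le> ?B" if "x \<in> K" "b \<in> Basis" for x b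
    using M[OF that(1), of b] member_le_sum[of b Basis "\<lambda>b. \<bar>M b\<bar>"] that by fastforce
  show thesis
  proof (rule that[of "real DIM('a) * ?B"])
    show "0 \<le> real DIM('a) * ?B" by (simp add: sum_nonneg)
    fix x v assume "x \<in> K"
    then have "linear (frechet_derivative f (at x))"
      using f K by (auto intro: linear_frechet_derivative)
    then show "norm (frechet_derivative f (at x) v) \<le> real DIM('a) * ?B * norm v"
      using linear_bound_from_Basis Mb[OF \<open>x \<in> K\<close>] by blast
  qed
qed

lemma Ck_on_Lipschitz_on_compact_convex:
  fixes f :: "'a::euclidean_space \<Rightarrow> 'b::real_normed_vector"
  assumes f: "Ck_on (Suc k) f U" and K: "compact K" "convex K" "K \<subseteq> U"
  obtains B where "0 \<le> B" and "\<And>x y. x \<in> K \<Longrightarrow> y \<in> K \<Longrightarrow> norm (f x - f y) \<le> B * norm (x - y)"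
proof -
  obtain B where B: "0 \<le> B"
      "\<And>x v. x \<in> K \<Longrightarrow> norm (frechet_derivative f (at x) v) \<le> B * norm v"
    using Ck_on_bounded_derivative[OF f \<open>compact K\<close> \<open>K \<subseteq> U\<close>] by blast
  show thesis
  proof (rule that[OF \<open>0 \<le> B\<close>], rule differentiable_bound[OF \<open>convex K\<close>])
    fix x assume "x \<in> K"
    with f K have "f differentiable (at x)" by auto
    then show "(f has_derivative frechet_derivative f (at x)) (at x within K)"
      by (simp add: frechet_derivative_works has_derivative_at_withinI)
    show "onorm (frechet_derivative f (at x)) \<le> B"
      using B(2)[OF \<open>x \<in> K\<close>] by (rule onorm_le)
  qed auto
qed

section \<open>Joining points in a domain with smooth boundary\<close>

text \<open>The domain is quasiconvex with constant \<open>C\<close> if this holds for all its pairs of points. Bounding the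
  speed instead of the length of the curve lets the mean value inequality apply directly.\<close>

definition joinable :: "('a::real_normed_vector) set \<Rightarrow> real \<Rightarrow> 'a \<Rightarrow> 'a \<Rightarrow> bool" where
  "joinable \<Omega> C x y \<longleftrightarrow> (\<exists>c c'. c (0::real) = x \<and> c 1 = y \<and>
     (\<forall>t\<in>{0..1}. c t \<in> \<Omega> \<and> (c has_vector_derivative c' t) (at t within {0..1}) \<and>
        norm (c' t) \<le> C * norm (y - x)))"

lemma joinable_convex:
  assumes "convex \<Omega>" "x \<in> \<Omega>" "y \<in> \<Omega>"
  shows "joinable \<Omega> 1 x y"
  unfolding joinable_def
proof (intro exI conjI ballI)
  let ?c = "\<lambda>t. x + t *\<^sub>R (y - x)"
  fix t :: real assume t: "t \<in> {0..1}"
  have "?c t = (1 - t) *\<^sub>R x + t *\<^sub>R y" by (simp add: algebra_simps)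
  then show "?c t \<in> \<Omega>"
    using assms t by (simp add: convexD_alt)
  show "(?c has_vector_derivative (y - x)) (at t within {0..1})"
    by (auto intro!: derivative_eq_intros simp: has_vector_derivative_def)
qed auto

lemma joinable_mono: "joinable \<Omega> C x y \<Longrightarrow> \<Omega> \<subseteq> \<Omega>' \<Longrightarrow> joinable \<Omega>' C x y"
proof -
  assume "joinable \<Omega> C x y" and sub: "\<Omega> \<subseteq> \<Omega>'"
  then obtain c c' where "c (0::real) = x" "c 1 = y"
    "\<forall>t\<in>{0..1}. c t \<in> \<Omega> \<and> (c has_vector_derivative c' t) (at t within {0..1}) \<and>
        norm (c' t) \<le> C * norm (y - x)"
    unfolding joinable_def by blast
  with sub show "joinable \<Omega>' C x y"
    unfolding joinable_def by - (rule exI[where x=c], rule exI[where x=c'], auto)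
qed

lemma locally_joinable_interior:
  fixes \<Omega> :: "('a::euclidean_space) set"
  assumes "open \<Omega>" "z \<in> \<Omega>"
  obtains V where "open V" "z \<in> V" "\<And>x y. x \<in> \<Omega> \<inter> V \<Longrightarrow> y \<in> \<Omega> \<inter> V \<Longrightarrow> joinable \<Omega> 1 x y"
proof -
  obtain r where r: "r > 0" "ball z r \<subseteq> \<Omega>" using assms openE by blast
  show thesis
  proof (rule that[of "ball z r"])
    fix x y assume "x \<in> \<Omega> \<inter> ball z r" "y \<in> \<Omega> \<inter> ball z r"
    then have "joinable (ball z r) 1 x y" by (intro joinable_convex) auto
    then show "joinable \<Omega> 1 x y" using r joinable_mono by blast
  qed (use r in auto)
qed

text \<open>In a chart that straightens the boundary, \<open>\<Omega>\<close> becomes locally the intersection of a ball with a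
  half-space, which is convex. The preimages of its segments are the curves; their speed is
  controlled by the Lipschitz constants of the chart and of its inverse.\<close>

lemma locally_joinable_boundary:
  fixes \<Omega> :: "('a::euclidean_space) set"
  assumes bd: "Ck_boundary (Suc k) \<Omega>" and z: "z \<in> frontier \<Omega>"
  obtains V C where "open V" "z \<in> V" "\<And>x y. x \<in> \<Omega> \<inter> V \<Longrightarrow> y \<in> \<Omega> \<inter> V \<Longrightarrow> joinable \<Omega> C x y"
proof -
  obtain U and W :: "'a set" and F F' e where UW: "open U" "z \<in> U" "open W" and hom: "homeomorphism U W F F'"
    and CF: "Ck_on (Suc k) F U" and CF': "Ck_on (Suc k) F' W"
    and im: "F ` (U \<inter> \<Omega>) = W \<inter> {y. 0 < e \<bullet> y}"
    using bd[unfolded Ck_boundary_def, rule_format, OF z] by blast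
  have "F z \<in> W" using hom UW by (auto simp: homeomorphism_def)
  then obtain \<rho> where \<rho>: "\<rho> > 0" "cball (F z) \<rho> \<subseteq> W"
    using \<open>open W\<close> open_contains_cball by blast
  have "continuous_on U F" using hom by (simp add: homeomorphism_def)
  then have "open (U \<inter> F -` ball (F z) \<rho>)"
    using UW by (simp add: continuous_open_preimage)
  moreover have "z \<in> U \<inter> F -` ball (F z) \<rho>" using UW \<rho> by auto
  ultimately obtain r where r: "r > 0" "cball z r \<subseteq> U \<inter> F -` ball (F z) \<rho>"
    using open_contains_cball by metis
  obtain B where B: "0 \<le> B" "\<And>x y. x \<in> cball z r \<Longrightarrow> y \<in> cball z r \<Longrightarrow> norm (F x - F y) \<le> B * norm (x - y)"
    using Ck_on_Lipschitz_on_compact_convex[OF CF, of "cball z r"] r by auto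
  obtain B' where B': "0 \<le> B'"
      "\<And>w v. w \<in> cball (F z) \<rho> \<Longrightarrow> norm (frechet_derivative F' (at w) v) \<le> B' * norm v"
    using Ck_on_bounded_derivative[OF CF', of "cball (F z) \<rho>"] \<rho> by auto
  show thesis
  proof (rule that[of "ball z r" "B' * B"])
    show "open (ball z r)" "z \<in> ball z r" using r by auto
    fix x y assume x: "x \<in> \<Omega> \<inter> ball z r" and y: "y \<in> \<Omega> \<inter> ball z r"
    have xr: "x \<in> cball z r" and yr: "y \<in> cball z r" using x y by auto
    have xU: "x \<in> U \<inter> \<Omega>" and yU: "y \<in> U \<inter> \<Omega>" using x y xr yr r by auto
    \<comment> \<open>The segment between the images stays where the chart is invertible and on the side of \<open>\<Omega>\<close>.\<close>
    define D where "D = ball (F z) \<rho> \<inter> {w. 0 < e \<bullet> w}"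
    have "convex D" unfolding D_def
      by (intro convex_Int convex_ball convex_halfspace_gt)
    have D: "F x \<in> D" "F y \<in> D"
      using xr yr r xU yU im unfolding D_def by auto
    let ?c = "\<lambda>t. F x + t *\<^sub>R (F y - F x)"
    have cD: "?c t \<in> D" if "t \<in> {0..1}" for t
    proof -
      have "?c t = (1 - t) *\<^sub>R F x + t *\<^sub>R F y" by (simp add: algebra_simps)
      then show ?thesis using \<open>convex D\<close> D that by (simp add: convexD_alt)
    qed
    show "joinable \<Omega> (B' * B) x y"
      unfolding joinable_def
    proof (intro exI conjI ballI)
      show "(F' \<circ> ?c) 0 = x" "(F' \<circ> ?c) 1 = y"
        using hom xU yU by (auto simp: homeomorphism_def)
      fix t :: real assume t: "t \<in> {0..1}"
      have ct: "?c t \<in> D" "?c t \<in> cball (F z) \<rho>" "?c t \<in> W"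
        using cD[OF t] \<rho> unfolding D_def by auto
      then obtain u where u: "u \<in> U \<inter> \<Omega>" "?c t = F u"
        using im unfolding D_def by blast
      then show "(F' \<circ> ?c) t \<in> \<Omega>"
        using hom by (auto simp: homeomorphism_def)
      have "(?c has_vector_derivative (F y - F x)) (at t within {0..1})"
        by (auto intro!: derivative_eq_intros simp: has_vector_derivative_def)
      moreover have "(F' has_derivative frechet_derivative F' (at (?c t))) (at (?c t))"
        using CF' ct by (simp add: frechet_derivative_works[symmetric])
      ultimately show "((F' \<circ> ?c) has_vector_derivative
          frechet_derivative F' (at (?c t)) (F y - F x)) (at t within {0..1})"
        by (simp add: vector_diff_chain_within has_derivative_at_withinI
            vector_derivative_diff_chain_within)
      have "norm (frechet_derivative F' (at (?c t)) (F y - F x)) \<le> B' * norm (F y - F x)"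
        using B' ct by blast
      also have "\<dots> \<le> B' * (B * norm (y - x))"
        using B B' xr yr by (intro mult_left_mono) auto
      finally show "norm (frechet_derivative F' (at (?c t)) (F y - F x)) \<le> B' * B * norm (y - x)"
        by simp
    qed
  qed
qed

section \<open>Symmetry of the Hessian\<close>

text \<open>The second difference of \<open>\<phi>\<close> is the increment of \<open>z \<mapsto> \<phi> (z + k) - \<phi> z\<close> along \<open>h\<close>, and the gradient of
  this function is close to \<open>H *v k\<close>. The left-hand side without the bilinear term is symmetric in \<open>h\<close>
  and \<open>k\<close>, from which the symmetry of \<open>H\<close> follows.\<close>

lemma second_difference_bound:
  fixes \<phi> :: "real^'n \<Rightarrow> real" and G :: "real^'n \<Rightarrow> real^'n" and H :: "real^'n^'n"
  assumes \<phi>: "\<And>z. z \<in> ball x r \<Longrightarrow> (\<phi> has_derivative (\<lambda>h. G z \<bullet> h)) (at z)"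
    and G: "\<And>k. norm k < r \<Longrightarrow> norm (G (x + k) - G x - H *v k) \<le> \<epsilon> * norm k"
    and "0 \<le> \<epsilon>" and hk: "norm h + norm k < r"
  shows "\<bar>\<phi> (x + h + k) - \<phi> (x + h) - \<phi> (x + k) + \<phi> x - h \<bullet> (H *v k)\<bar>
           \<le> 2 * \<epsilon> * (norm h + norm k) * norm h"
proof -
  \<comment> \<open>The subtracted linear function makes the gradient of \<open>f\<close> small along \<open>h\<close>.\<close>
  define f where "f z = \<phi> (z + k) - \<phi> z - z \<bullet> (H *v k)" for z
  let ?c = "\<lambda>t. x + t *\<^sub>R h"
  have "norm (f (?c 1) - f (?c 0)) \<le> (2 * \<epsilon> * (norm h + norm k)) * norm h"
  proof (rule curve_mean_value[where c="?c" and c'="\<lambda>_. h" and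
        f'="\<lambda>z v. (G (z + k) - G z - H *v k) \<bullet> v"])
    fix t :: real assume t: "t \<in> {0..1}"
    show "(?c has_vector_derivative h) (at t within {0..1})"
      by (auto intro!: derivative_eq_intros simp: has_vector_derivative_def)
    have th: "norm (t *\<^sub>R h) \<le> norm h"
      using t by (simp add: mult_left_le_one_le)
    have thk: "norm (t *\<^sub>R h + k) \<le> norm h + norm k"
      using th norm_triangle_ineq[of "t *\<^sub>R h" k] by linarith
    have n1: "norm (t *\<^sub>R h) < r" using th hk norm_ge_zero[of k] by linarith
    have n2: "norm (t *\<^sub>R h + k) < r" using thk hk by linarith
    have in1: "?c t \<in> ball x r" using n1 by (simp add: dist_norm)
    have in2: "?c t + k \<in> ball x r"
      using n2 norm_minus_cancel[of "t *\<^sub>R h + k"] by (simp add: dist_norm algebra_simps)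
    have d2: "((\<lambda>z. \<phi> (z + k)) has_derivative (\<lambda>v. G (?c t + k) \<bullet> v)) (at (?c t))"
    proof -
      have "((\<lambda>z. z + k) has_derivative (\<lambda>v. v)) (at (?c t))"
        by (auto intro!: derivative_eq_intros)
      from has_derivative_compose[OF this, of \<phi>] \<phi>[OF in2] show ?thesis by simp
    qed
    show "(f has_derivative (\<lambda>v. (G (?c t + k) - G (?c t) - H *v k) \<bullet> v)) (at (?c t))"
      unfolding f_def
      using has_derivative_diff[OF has_derivative_diff[OF d2 \<phi>[OF in1]]
          has_derivative_inner_left[OF has_derivative_ident, of "H *v k"]]
      by (simp add: inner_diff_left inner_diff_right inner_commute)
    fix v
    have "G (?c t + k) - G (?c t) - H *v k
        = (G (x + (t *\<^sub>R h + k)) - G x - H *v (t *\<^sub>R h + k)) - (G (x + t *\<^sub>R h) - G x - H *v (t *\<^sub>R h))"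
      by (simp add: algebra_simps)
    also have "norm \<dots> \<le> \<epsilon> * norm (t *\<^sub>R h + k) + \<epsilon> * norm (t *\<^sub>R h)"
      by (rule order_trans[OF norm_triangle_ineq4]) (intro add_mono G n1 n2)
    also have "\<dots> \<le> \<epsilon> * (norm h + norm k) + \<epsilon> * (norm h + norm k)"
      using th thk \<open>0 \<le> \<epsilon>\<close> by (intro add_mono mult_left_mono) (auto intro: order_trans)
    finally have "norm (G (?c t + k) - G (?c t) - H *v k) \<le> 2 * \<epsilon> * (norm h + norm k)"
      by simp
    then show "norm ((G (?c t + k) - G (?c t) - H *v k) \<bullet> v) \<le> 2 * \<epsilon> * (norm h + norm k) * norm v"
      by (metis Cauchy_Schwarz_ineq2 mult_right_mono norm_ge_zero order_trans real_norm_def)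
  qed (use \<open>0 \<le> \<epsilon>\<close> in auto)
  then show ?thesis
    unfolding f_def by (simp add: algebra_simps)
qed

text \<open>Comparing the two estimates of the second difference for the increments \<open>t *\<^sub>R u\<close>, \<open>t *\<^sub>R v\<close> in either
  order gives an error \<open>o(t\<^sup>2)\<close> for a quantity that is homogeneous of degree two in \<open>t\<close>.\<close>

lemma hessian_symmetric:
  fixes \<phi> :: "real^'n \<Rightarrow> real" and G :: "real^'n \<Rightarrow> real^'n" and H :: "real^'n^'n"
  assumes "open \<Omega>" "x \<in> \<Omega>"
    and \<phi>: "\<And>z. z \<in> \<Omega> \<Longrightarrow> (\<phi> has_derivative (\<lambda>h. G z \<bullet> h)) (at z)"
    and G: "(G has_derivative (\<lambda>h. H *v h)) (at x)"
  shows "u \<bullet> (H *v v) = v \<bullet> (H *v u)"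
proof -
  define b where "b = norm u + norm v + 1"
  have b: "b > 0" "norm u \<le> b" "norm v \<le> b" "norm u + norm v < b"
    using norm_ge_zero[of u] norm_ge_zero[of v] unfolding b_def by linarith+
  have "\<bar>u \<bullet> (H *v v) - v \<bullet> (H *v u)\<bar> \<le> e" if "e > 0" for e
  proof -
    \<comment> \<open>This choice makes the sum of the two errors equal to \<open>e\<close> after division by \<open>t * t\<close>.\<close>
    define \<epsilon> where "\<epsilon> = e / (4 * b * b)"
    have "\<epsilon> > 0" using that b by (simp add: \<epsilon>_def)
    obtain r1 where r1: "r1 > 0" "ball x r1 \<subseteq> \<Omega>" using assms openE by blast
    obtain r2 where r2: "r2 > 0"
        "\<And>y. norm (y - x) < r2 \<Longrightarrow> norm (G y - G x - H *v (y - x)) \<le> \<epsilon> * norm (y - x)"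
      using G \<open>\<epsilon> > 0\<close> unfolding has_derivative_at_alt by blast
    define r where "r = min r1 r2"
    define t where "t = r / b"
    have "r > 0" using r1 r2 by (simp add: r_def)
    then have "t > 0" using b by (simp add: t_def)
    have tb: "t * b = r" using b by (simp add: t_def)
    have G': "norm (G (x + k) - G x - H *v k) \<le> \<epsilon> * norm k" if "norm k < r" for k
      using r2(2)[of "x + k"] that by (simp add: r_def)
    have \<phi>': "(\<phi> has_derivative (\<lambda>h. G z \<bullet> h)) (at z)" if "z \<in> ball x r" for z
      using that r1 by (intro \<phi>) (auto simp: r_def)
    let ?u = "t *\<^sub>R u" and ?v = "t *\<^sub>R v"
    have nu: "norm ?u = t * norm u" "norm ?v = t * norm v" using \<open>t > 0\<close> by auto
    have sm: "norm ?u + norm ?v < r"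
      using b(4) \<open>t > 0\<close> unfolding nu tb[symmetric] by (metis distrib_left mult_strict_left_mono)
    have bd: "2 * \<epsilon> * (norm p + norm q) * norm p \<le> 2 * \<epsilon> * (t * b) * (t * b)"
      if "norm p + norm q < r" for p q :: "real^'n"
      unfolding tb
    proof (intro mult_mono mult_left_mono)
      show "norm p + norm q \<le> r" "norm p \<le> r"
        using that norm_ge_zero[of q] by linarith+
    qed (use \<open>\<epsilon> > 0\<close> \<open>r > 0\<close> in auto)
    have "\<bar>?u \<bullet> (H *v ?v) - ?v \<bullet> (H *v ?u)\<bar> \<le> 2 * (2 * \<epsilon> * (t * b) * (t * b))"
    proof -
      define S where "S = \<phi> (x + ?u + ?v) - \<phi> (x + ?u) - \<phi> (x + ?v) + \<phi> x"
      have S': "\<phi> (x + ?v + ?u) - \<phi> (x + ?v) - \<phi> (x + ?u) + \<phi> x = S"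
        by (simp add: S_def add.assoc add.commute[of ?u ?v])
      have sm': "norm ?v + norm ?u < r" using sm by linarith
      have "\<bar>S - ?u \<bullet> (H *v ?v)\<bar> \<le> 2 * \<epsilon> * (norm ?u + norm ?v) * norm ?u"
        unfolding S_def
        by (rule second_difference_bound[where r=r, OF \<phi>' G' _ sm]) (use \<open>\<epsilon> > 0\<close> in auto)
      moreover have "\<bar>S - ?v \<bullet> (H *v ?u)\<bar> \<le> 2 * \<epsilon> * (norm ?v + norm ?u) * norm ?v"
        unfolding S'[symmetric]
        by (rule second_difference_bound[where r=r, OF \<phi>' G' _ sm']) (use \<open>\<epsilon> > 0\<close> in auto)
      ultimately show ?thesis using bd[OF sm] bd[OF sm'] by linarith
    qed
    moreover have "?u \<bullet> (H *v ?v) - ?v \<bullet> (H *v ?u) = (t * t) * (u \<bullet> (H *v v) - v \<bullet> (H *v u))"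
      by (simp add: matrix_vector_mult_scaleR algebra_simps)
    ultimately have "\<bar>(t * t) * (u \<bullet> (H *v v) - v \<bullet> (H *v u))\<bar> \<le> 2 * (2 * \<epsilon> * (t * b) * (t * b))"
      by simp
    then have "(t * t) * \<bar>u \<bullet> (H *v v) - v \<bullet> (H *v u)\<bar> \<le> (t * t) * (4 * \<epsilon> * b * b)"
      unfolding abs_mult by (simp add: ac_simps)
    moreover have "t * t > 0" using \<open>t > 0\<close> by simp
    ultimately have "\<bar>u \<bullet> (H *v v) - v \<bullet> (H *v u)\<bar> \<le> 4 * \<epsilon> * b * b"
      using mult_le_cancel_left_pos by blast
    also have "\<dots> = e" using b by (simp add: \<epsilon>_def)
    finally show ?thesis .
  qed
  then have "\<bar>u \<bullet> (H *v v) - v \<bullet> (H *v u)\<bar> \<le> 0"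
    by (rule field_le_epsilon) simp
  then show ?thesis by simp
qed

section \<open>Taylor expansion up to the boundary\<close>

definition taylor_remainder ::
  "(real^'n \<Rightarrow> real) \<Rightarrow> (real^'n \<Rightarrow> real^'n) \<Rightarrow> (real^'n \<Rightarrow> real^'n^'n) \<Rightarrow> real^'n \<Rightarrow> real^'n \<Rightarrow> real" where
  "taylor_remainder \<phi> G H x y =
     \<phi> y - \<phi> x - G x \<bullet> (y - x) - 1/2 * ((y - x) \<bullet> (H x *v (y - x)))"

text \<open>The bound on the third derivatives is integrated three times along the curve: for \<open>H\<close>, for the first
  order expansion of \<open>G\<close>, and for the second order expansion of \<open>\<phi>\<close>. On a curve that is not straight
  the last step requires the gradient of \<open>z \<mapsto> (z - x) \<bullet> (H x *v (z - x)) / 2\<close> to be \<open>H x *v (z - x)\<close>,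
  which is the symmetry of the Hessian.\<close>

lemma taylor_along_curve:
  fixes \<phi> :: "real^'n \<Rightarrow> real" and G :: "real^'n \<Rightarrow> real^'n" and H :: "real^'n \<Rightarrow> real^'n^'n"
  assumes "open \<Omega>" and x: "x \<in> \<Omega>" and join: "joinable \<Omega> C x y"
    and \<phi>: "\<And>z. z \<in> \<Omega> \<Longrightarrow> (\<phi> has_derivative (\<lambda>h. G z \<bullet> h)) (at z)"
    and G: "\<And>z. z \<in> \<Omega> \<Longrightarrow> (G has_derivative (\<lambda>h. H z *v h)) (at z)"
    and H: "\<And>i j z. z \<in> \<Omega> \<Longrightarrow> ((\<lambda>z. H z $ i $ j) has_derivative E i j z) (at z)"
    and E: "\<And>i j z v. z \<in> \<Omega> \<Longrightarrow> \<bar>E i j z v\<bar> \<le> M * norm v" and "0 \<le> M"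
  shows "\<bar>taylor_remainder \<phi> G H x y\<bar> \<le> real CARD('n) ^ 2 * M * (C * norm (y - x)) ^ 3"
proof -
  obtain c c' where c0: "c (0::real) = x" and c1: "c 1 = y"
    and c: "\<And>t. t \<in> {0..1} \<Longrightarrow> c t \<in> \<Omega>"
      "\<And>t. t \<in> {0..1} \<Longrightarrow> (c has_vector_derivative c' t) (at t within {0..1})"
      "\<And>t. t \<in> {0..1} \<Longrightarrow> norm (c' t) \<le> C * norm (y - x)"
    using join unfolding joinable_def by blast
  define L where "L = C * norm (y - x)"
  define B where "B = real CARD('n) * real CARD('n) * (M * L)"
  have "0 \<le> L" using order_trans[OF norm_ge_zero c(3)[of 0]] by (simp add: L_def)
  have "0 \<le> B" using \<open>0 \<le> L\<close> \<open>0 \<le> M\<close> by (simp add: B_def)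
  note mean_value = curve_mean_value[where c = c and c' = c' and L = L,
      OF c(2) c(3)[folded L_def], unfolded c0]
  have ent: "\<bar>(H (c t) - H x) $ i $ j\<bar> \<le> M * L" if "t \<in> {0..1}" for i j t
    using mean_value[where f = "\<lambda>z. H z $ i $ j" and f' = "E i j" and B = M]
      c(1) H E \<open>0 \<le> M\<close> that by simp
  have Hb: "norm ((H (c t) - H x) *v v) \<le> B * norm v" if "t \<in> {0..1}" for t v
  proof -
    have "norm ((H (c t) - H x) *v v) \<le> onorm ((*v) (H (c t) - H x)) * norm v"
      by (rule onorm) simp
    also have "\<dots> \<le> B * norm v"
      unfolding B_def using ent[OF that] by (intro mult_right_mono onorm_le_matrix_component) auto
    finally show ?thesis .
  qed
  have Gb: "norm (G (c t) - G x - H x *v (c t - x)) \<le> B * L" if "t \<in> {0..1}" for t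
  proof -
    have "norm ((G (c t) - H x *v c t) - (G x - H x *v x)) \<le> B * L"
    proof (rule mean_value[where f' = "\<lambda>z v. (H z - H x) *v v"])
      fix s :: real assume s: "s \<in> {0..1}"
      show "((\<lambda>z. G z - H x *v z) has_derivative (\<lambda>v. (H (c s) - H x) *v v)) (at (c s))"
        using has_derivative_diff[OF G[OF c(1)[OF s]]
            bounded_linear_imp_has_derivative[OF matrix_vector_mul_bounded_linear[of "H x"]]]
        by (simp add: matrix_vector_mult_diff_rdistrib)
    qed (use Hb \<open>0 \<le> B\<close> that in auto)
    then show ?thesis by (simp add: algebra_simps)
  qed
  define f where "f z = \<phi> z - G x \<bullet> z - 1/2 * ((z - x) \<bullet> (H x *v (z - x)))" for z
  have "norm (f (c 1) - f x) \<le> (B * L) * L"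
  proof (rule mean_value[where f' = "\<lambda>z v. (G z - G x - H x *v (z - x)) \<bullet> v"])
    fix s :: real assume s: "s \<in> {0..1}"
    have sym: "u \<bullet> (H x *v v) = v \<bullet> (H x *v u)" for u v
      using hessian_symmetric[OF \<open>open \<Omega>\<close> x \<phi> G[OF x]] by blast
    have d1: "((\<lambda>z. z - x) has_derivative (\<lambda>v. v)) (at (c s))"
      by (auto intro!: derivative_eq_intros)
    have d2: "((\<lambda>z. H x *v (z - x)) has_derivative (\<lambda>v. H x *v v)) (at (c s))"
      using bounded_linear.has_derivative[OF matrix_vector_mul_bounded_linear d1] .
    have d3: "((\<lambda>z. 1/2 * ((z - x) \<bullet> (H x *v (z - x)))) has_derivative
        (\<lambda>v. 1/2 * ((c s - x) \<bullet> (H x *v v) + v \<bullet> (H x *v (c s - x))))) (at (c s))"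
      by (intro has_derivative_mult_right has_derivative_inner d1 d2)
    have d4: "((\<lambda>z. G x \<bullet> z) has_derivative (\<lambda>v. G x \<bullet> v)) (at (c s))"
      by (intro has_derivative_inner_right has_derivative_ident)
    have "(f has_derivative (\<lambda>v. G (c s) \<bullet> v - G x \<bullet> v
        - 1/2 * ((c s - x) \<bullet> (H x *v v) + v \<bullet> (H x *v (c s - x))))) (at (c s))"
      unfolding f_def by (intro has_derivative_diff \<phi> c(1) s d3 d4)
    moreover have "G (c s) \<bullet> v - G x \<bullet> v - 1/2 * ((c s - x) \<bullet> (H x *v v) + v \<bullet> (H x *v (c s - x)))
        = (G (c s) - G x - H x *v (c s - x)) \<bullet> v" for v
      using sym[of "c s - x" v] by (simp add: inner_diff_left inner_commute[of v])
    ultimately show "(f has_derivative (\<lambda>v. (G (c s) - G x - H x *v (c s - x)) \<bullet> v)) (at (c s))"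
      by simp
    fix v
    have "norm ((G (c s) - G x - H x *v (c s - x)) \<bullet> v) \<le> norm (G (c s) - G x - H x *v (c s - x)) * norm v"
      using Cauchy_Schwarz_ineq2 by simp
    also have "\<dots> \<le> B * L * norm v" using Gb[OF s] by (rule mult_right_mono) simp
    finally show "norm ((G (c s) - G x - H x *v (c s - x)) \<bullet> v) \<le> B * L * norm v" .
  qed (use \<open>0 \<le> B\<close> \<open>0 \<le> L\<close> in auto)
  moreover have "f (c 1) - f x = taylor_remainder \<phi> G H x y"
    unfolding f_def taylor_remainder_def c1 by (simp add: inner_diff_right)
  moreover have "B * L * L = real CARD('n) ^ 2 * M * L ^ 3"
    by (simp add: B_def power2_eq_square power3_eq_cube)
  ultimately show ?thesis by (simp add: L_def)
qed

lemma Ck_closure_Suc_derivative: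
  assumes "Ck_closure (Suc k) f \<Omega>"
  obtains g where "\<And>x. x \<in> \<Omega> \<Longrightarrow> g x = frechet_derivative f (at x) v" "Ck_closure k g \<Omega>"
  using assms unfolding Ck_closure.simps by metis

text \<open>Differentiating \<open>\<phi>\<close> along two axes gives an entry of \<open>H\<close>; each of its directional derivatives is a third
  derivative of \<open>\<phi>\<close>, which extends continuously to the compact closure.\<close>

lemma hessian_entry_bounded_derivative:
  fixes \<phi> :: "real^'n \<Rightarrow> real" and G :: "real^'n \<Rightarrow> real^'n" and H :: "real^'n \<Rightarrow> real^'n^'n"
  assumes "open \<Omega>" "bounded \<Omega>" and C3: "Ck_closure 3 \<phi> \<Omega>"
    and \<phi>: "\<And>z. z \<in> \<Omega> \<Longrightarrow> (\<phi> has_derivative (\<lambda>h. G z \<bullet> h)) (at z)"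
    and G: "\<And>z. z \<in> \<Omega> \<Longrightarrow> (G has_derivative (\<lambda>h. H z *v h)) (at z)"
  shows "\<exists>E M. 0 \<le> M \<and> (\<forall>z\<in>\<Omega>. ((\<lambda>z. H z $ i $ j) has_derivative E z) (at z) \<and>
           (\<forall>v. \<bar>E z v\<bar> \<le> M * norm v))"
proof -
  obtain g where g: "\<And>z. z \<in> \<Omega> \<Longrightarrow> g z = frechet_derivative \<phi> (at z) (axis i 1)"
      and C2: "Ck_closure (Suc (Suc 0)) g \<Omega>"
    using Ck_closure_Suc_derivative[OF C3[unfolded numeral_3_eq_3]] by metis
  have g': "g z = G z $ i" if "z \<in> \<Omega>" for z
    using g[OF that] frechet_derivative_at[OF \<phi>[OF that]] by (metis inner_axis inner_real_def mult.right_neutral)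
  have dg: "(g has_derivative (\<lambda>h. (H z *v h) $ i)) (at z)" if z: "z \<in> \<Omega>" for z
    by (rule has_derivative_transform_within_open[where f="\<lambda>z. G z $ i", OF _ \<open>open \<Omega>\<close> z])
      (use g' bounded_linear.has_derivative[OF bounded_linear_vec_nth G[OF z]] in auto)
  obtain h where h: "\<And>z. z \<in> \<Omega> \<Longrightarrow> h z = frechet_derivative g (at z) (axis j 1)"
      and C1: "Ck_closure (Suc 0) h \<Omega>"
    using Ck_closure_Suc_derivative[OF C2] by metis
  have h': "h z = H z $ i $ j" if "z \<in> \<Omega>" for z
  proof -
    have "h z = (H z *v axis j 1) $ i"
      using h[OF that] frechet_derivative_at[OF dg[OF that]] by metis
    then show ?thesis by (simp add: matrix_vector_mul_component inner_axis)
  qed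
  have dh: "(h has_derivative frechet_derivative h (at z)) (at z)" if "z \<in> \<Omega>" for z
    using C1 that by (simp add: frechet_derivative_works[symmetric])
  have "\<exists>M. \<forall>z\<in>\<Omega>. \<bar>frechet_derivative h (at z) u\<bar> \<le> M" for u
  proof -
    obtain k where k: "\<And>z. z \<in> \<Omega> \<Longrightarrow> k z = frechet_derivative h (at z) u"
        and "continuous_on (closure \<Omega>) k"
      using Ck_closure_Suc_derivative[OF C1] by (metis Ck_closure.simps(1))
    then have "bounded (k ` closure \<Omega>)"
      using \<open>bounded \<Omega>\<close> by (intro compact_imp_bounded compact_continuous_image) auto
    then obtain M where "\<And>z. z \<in> closure \<Omega> \<Longrightarrow> \<bar>k z\<bar> \<le> M" by (auto simp: bounded_iff)
    then show ?thesis using k closure_subset by (metis subsetD)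
  qed
  then obtain M where M: "\<And>u z. z \<in> \<Omega> \<Longrightarrow> \<bar>frechet_derivative h (at z) u\<bar> \<le> M u" by metis
  let ?B = "\<Sum>b\<in>Basis. \<bar>M b\<bar>"
  have Mb: "norm (frechet_derivative h (at z) b) \<le> ?B" if "z \<in> \<Omega>" "b \<in> Basis" for z b
    using M[OF that(1), of b] member_le_sum[of b Basis "\<lambda>b. \<bar>M b\<bar>"] that by fastforce
  show ?thesis
  proof (intro exI conjI ballI allI)
    show "0 \<le> real DIM(real^'n) * ?B" by (simp add: sum_nonneg)
    fix z assume z: "z \<in> \<Omega>"
    show "((\<lambda>z. H z $ i $ j) has_derivative frechet_derivative h (at z)) (at z)"
      by (rule has_derivative_transform_within_open[OF dh[OF z] \<open>open \<Omega>\<close> z]) (use h' in auto)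
    show "\<bar>frechet_derivative h (at z) v\<bar> \<le> real DIM(real^'n) * ?B * norm v" for v
      using linear_bound_from_Basis[OF has_derivative_linear[OF dh[OF z]] Mb[OF z], of v] by simp
  qed
qed

text \<open>A Lebesgue number argument: constants that exist near each point of a compact set can be chosen
  uniformly for all pairs of close points.\<close>

lemma compact_uniform_local_bound:
  fixes Q :: "'a::metric_space \<Rightarrow> 'a \<Rightarrow> real \<Rightarrow> bool"
  assumes "compact K" and mono: "\<And>x y C C'. Q x y C \<Longrightarrow> C \<le> C' \<Longrightarrow> Q x y C'"
    and loc: "\<And>z. z \<in> K \<Longrightarrow> \<exists>V C. open V \<and> z \<in> V \<and> (\<forall>x\<in>V. \<forall>y\<in>V. Q x y C)"
  obtains r C where "0 < r" "0 \<le> C" "\<And>x y. x \<in> K \<Longrightarrow> dist x y < r \<Longrightarrow> Q x y C"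
proof -
  obtain V C where V: "\<And>z. z \<in> K \<Longrightarrow> open (V z)" "\<And>z. z \<in> K \<Longrightarrow> z \<in> V z"
    and C: "\<And>z x y. z \<in> K \<Longrightarrow> x \<in> V z \<Longrightarrow> y \<in> V z \<Longrightarrow> Q x y (C z)"
    using loc by metis
  obtain Z where Z: "Z \<subseteq> K" "finite Z" "K \<subseteq> (\<Union>z\<in>Z. V z)"
    using compactE_image[OF \<open>compact K\<close>, of K V] V by blast
  have "\<And>G. G \<in> V ` Z \<Longrightarrow> open G" using V Z by auto
  from Heine_Borel_lemma[OF \<open>compact K\<close> Z(3) this]
  obtain r where r: "0 < r" "\<And>x. x \<in> K \<Longrightarrow> \<exists>G\<in>V ` Z. ball x r \<subseteq> G" by blast
  show thesis
  proof (rule that[OF \<open>0 < r\<close>])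
    show "0 \<le> (\<Sum>z\<in>Z. \<bar>C z\<bar>)" by (simp add: sum_nonneg)
    fix x y assume x: "x \<in> K" and d: "dist x y < r"
    obtain z where z: "z \<in> Z" "ball x r \<subseteq> V z" using r(2)[OF x] by blast
    have "x \<in> ball x r" "y \<in> ball x r" using d \<open>0 < r\<close> by auto
    then have "Q x y (C z)" using C[of z x y] z Z by blast
    moreover have "C z \<le> (\<Sum>z\<in>Z. \<bar>C z\<bar>)"
      using member_le_sum[of z Z "\<lambda>z. \<bar>C z\<bar>"] z Z by force
    ultimately show "Q x y (\<Sum>z\<in>Z. \<bar>C z\<bar>)" by (rule mono)
  qed
qed

lemma continuous_on_taylor_remainder:
  fixes \<phi> :: "real^'n \<Rightarrow> real"
  assumes "continuous_on S \<phi>" "continuous_on S G" "continuous_on S H"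
  shows "continuous_on (S \<times> S) (\<lambda>(x, y). taylor_remainder \<phi> G H x y)"
proof -
  have f: "continuous_on (S \<times> S) (\<lambda>p. f (fst p))" if "continuous_on S f"
    for f :: "real^'n \<Rightarrow> 'z::topological_space"
    by (rule continuous_on_compose2[OF that continuous_on_fst]) (auto intro: continuous_on_id)
  have s: "continuous_on (S \<times> S) (\<lambda>p. f (snd p))" if "continuous_on S f"
    for f :: "real^'n \<Rightarrow> 'z::topological_space"
    by (rule continuous_on_compose2[OF that continuous_on_snd]) (auto intro: continuous_on_id)
  show ?thesis
    unfolding taylor_remainder_def matrix_vector_mult_def case_prod_beta
    by (intro continuous_intros f s assms)
qed

text \<open>Near each point of the closure any two points of \<open>\<Omega>\<close> are joined by a curve of comparable length, which
  gives the estimate for them and, by continuity, for points of the closure. Compactness makes it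
  uniform for close points. For distant points it holds because the remainder is bounded.\<close>

lemma taylor_on_closure:
  fixes \<phi> :: "real^'n \<Rightarrow> real" and G :: "real^'n \<Rightarrow> real^'n" and H :: "real^'n \<Rightarrow> real^'n^'n"
  assumes "open \<Omega>" "bounded \<Omega>" and bd: "Ck_boundary (Suc k) \<Omega>" and C3: "Ck_closure 3 \<phi> \<Omega>"
    and grad: "gradient_on_closure \<Omega> \<phi> G" and hess: "hessian_on_closure \<Omega> \<phi> H"
  obtains C where "0 \<le> C"
    "\<And>x y. x \<in> closure \<Omega> \<Longrightarrow> y \<in> closure \<Omega> \<Longrightarrow> \<bar>taylor_remainder \<phi> G H x y\<bar> \<le> C * norm (y - x) ^ 3"
proof -
  have dphi: "\<And>z. z \<in> \<Omega> \<Longrightarrow> (\<phi> has_derivative (\<lambda>h. G z \<bullet> h)) (at z)"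
    using grad by (simp add: gradient_on_closure_def)
  obtain G' where G': "\<And>z. z \<in> \<Omega> \<Longrightarrow> (\<phi> has_derivative (\<lambda>h. G' z \<bullet> h)) (at z)"
    "\<And>z. z \<in> \<Omega> \<Longrightarrow> (G' has_derivative (\<lambda>h. H z *v h)) (at z)"
    using hess by (auto simp: hessian_on_closure_def gradient_on_closure_def)
  \<comment> \<open>The gradient is unique at interior points, so the field whose derivative is \<open>H\<close> may be taken to be \<open>G\<close>.\<close>
  have "G' z = G z" if "z \<in> \<Omega>" for z
    using has_derivative_unique[OF dphi[OF that] G'(1)[OF that]]
    by (metis vector_eq_rdot)
  then have dG: "(G has_derivative (\<lambda>h. H z *v h)) (at z)" if "z \<in> \<Omega>" for z
    using has_derivative_transform_within_open[OF G'(2)[OF that] \<open>open \<Omega>\<close> that] by simp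
  obtain E M where M: "\<And>i j. 0 \<le> M i j"
      "\<And>i j z. z \<in> \<Omega> \<Longrightarrow> ((\<lambda>z. H z $ i $ j) has_derivative E i j z) (at z)"
      "\<And>i j z v. z \<in> \<Omega> \<Longrightarrow> \<bar>E i j z v\<bar> \<le> M i j * norm v"
    using hessian_entry_bounded_derivative[OF \<open>open \<Omega>\<close> \<open>bounded \<Omega>\<close> C3 dphi dG] by metis
  define m where "m = (\<Sum>i\<in>UNIV. \<Sum>j\<in>UNIV. M i j)"
  have "M i j \<le> m" for i j
  proof -
    have "M i j \<le> (\<Sum>j\<in>UNIV. M i j)"
      by (rule member_le_sum) (use M in auto)
    also have "\<dots> \<le> m"
      unfolding m_def
      by (rule member_le_sum[where f = "\<lambda>i. \<Sum>j\<in>UNIV. M i j"]) (use M in \<open>auto intro: sum_nonneg\<close>)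
    finally show ?thesis .
  qed
  then have E: "\<bar>E i j z v\<bar> \<le> m * norm v" if "z \<in> \<Omega>" for i j z v
    using M(3)[OF that, of i j v] mult_right_mono[of "M i j" m "norm v"] by fastforce
  have m0: "0 \<le> m" unfolding m_def by (intro sum_nonneg M)
  let ?R = "taylor_remainder \<phi> G H"
  have cont: "continuous_on (closure \<Omega> \<times> closure \<Omega>) (\<lambda>(x, y). ?R x y)"
    by (rule continuous_on_taylor_remainder)
      (use C3 grad hess in \<open>auto simp: numeral_3_eq_3 gradient_on_closure_def hessian_on_closure_def\<close>)
  have loc: "\<exists>V C. open V \<and> z \<in> V \<and> (\<forall>x\<in>V. \<forall>y\<in>V. x \<in> closure \<Omega> \<longrightarrow> y \<in> closure \<Omega> \<longrightarrow>
      \<bar>?R x y\<bar> \<le> C * norm (y - x) ^ 3)" if z: "z \<in> closure \<Omega>" for z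
  proof -
    obtain V C where V: "open V" "z \<in> V" "\<And>x y. x \<in> \<Omega> \<inter> V \<Longrightarrow> y \<in> \<Omega> \<inter> V \<Longrightarrow> joinable \<Omega> C x y"
    proof (cases "z \<in> \<Omega>")
      case True
      then show ?thesis using locally_joinable_interior[OF \<open>open \<Omega>\<close>] that by metis
    next
      case False
      then have "z \<in> frontier \<Omega>" using z \<open>open \<Omega>\<close> by (simp add: frontier_def interior_open)
      then show ?thesis using locally_joinable_boundary[OF bd] that by metis
    qed
    define C' where "C' = real CARD('n) ^ 2 * m * C ^ 3"
    define f where "f = (\<lambda>(x, y). \<bar>?R x y\<bar> - C' * norm (y - x) ^ 3)"
    have inner: "f (x, y) \<le> 0" if "x \<in> \<Omega> \<inter> V" "y \<in> \<Omega> \<inter> V" for x y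
      using taylor_along_curve[OF \<open>open \<Omega>\<close> _ V(3)[OF that] dphi dG M(2) E m0] that
      by (simp add: f_def C'_def power_mult_distrib mult.assoc)
    have cl: "closure ((\<Omega> \<inter> V) \<times> (\<Omega> \<inter> V)) \<subseteq> closure \<Omega> \<times> closure \<Omega>"
      unfolding closure_Times by (intro Sigma_mono closure_mono) auto
    have "continuous_on (closure ((\<Omega> \<inter> V) \<times> (\<Omega> \<inter> V))) f"
      using continuous_on_subset[OF cont cl] unfolding f_def case_prod_beta
      by (intro continuous_intros) auto
    then have "f p \<le> 0" if "p \<in> closure ((\<Omega> \<inter> V) \<times> (\<Omega> \<inter> V))" for p
      by (rule continuous_le_on_closure[OF _ that]) (use inner in auto)
    moreover have "closure \<Omega> \<inter> V \<subseteq> closure (\<Omega> \<inter> V)"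
      using open_Int_closure_subset[OF \<open>open V\<close>, of \<Omega>] by (simp add: Int_commute)
    ultimately have "f (x, y) \<le> 0" if "x \<in> closure \<Omega> \<inter> V" "y \<in> closure \<Omega> \<inter> V" for x y
      using that unfolding closure_Times by blast
    then show ?thesis using V by (intro exI[of _ V] exI[of _ C']) (auto simp: f_def)
  qed
  have cpt: "compact (closure \<Omega>)" using \<open>bounded \<Omega>\<close> by simp
  obtain r C where r: "0 < r" and "0 \<le> C"
    and near: "\<And>x y. x \<in> closure \<Omega> \<Longrightarrow> dist x y < r \<Longrightarrow>
        x \<in> closure \<Omega> \<longrightarrow> y \<in> closure \<Omega> \<longrightarrow> \<bar>?R x y\<bar> \<le> C * norm (y - x) ^ 3"
  proof (rule compact_uniform_local_bound[OF cpt, of "\<lambda>x y C. x \<in> closure \<Omega> \<longrightarrow> y \<in> closure \<Omega> \<longrightarrow>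
      \<bar>?R x y\<bar> \<le> C * norm (y - x) ^ 3"])
    fix x y :: "real^'n" and C C' :: real
    assume "x \<in> closure \<Omega> \<longrightarrow> y \<in> closure \<Omega> \<longrightarrow> \<bar>?R x y\<bar> \<le> C * norm (y - x) ^ 3" "C \<le> C'"
    then show "x \<in> closure \<Omega> \<longrightarrow> y \<in> closure \<Omega> \<longrightarrow> \<bar>?R x y\<bar> \<le> C' * norm (y - x) ^ 3"
      by (meson mult_right_mono order_trans norm_ge_zero zero_le_power)
  qed (use loc in blast)+
  have "bounded ((\<lambda>(x, y). ?R x y) ` (closure \<Omega> \<times> closure \<Omega>))"
    using cpt by (intro compact_imp_bounded compact_continuous_image cont compact_Times)
  then obtain b where b: "\<And>x y. x \<in> closure \<Omega> \<Longrightarrow> y \<in> closure \<Omega> \<Longrightarrow> \<bar>?R x y\<bar> \<le> b"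
    by (fastforce simp: bounded_iff)
  show thesis
  proof (rule that[of "C + \<bar>b\<bar> / r ^ 3"])
    show "0 \<le> C + \<bar>b\<bar> / r ^ 3" using \<open>0 \<le> C\<close> r by simp
    fix x y assume xy: "x \<in> closure \<Omega>" "y \<in> closure \<Omega>"
    show "\<bar>?R x y\<bar> \<le> (C + \<bar>b\<bar> / r ^ 3) * norm (y - x) ^ 3"
    proof (cases "dist x y < r")
      case True
      then have "\<bar>?R x y\<bar> \<le> C * norm (y - x) ^ 3" using near xy by blast
      also have "\<dots> \<le> (C + \<bar>b\<bar> / r ^ 3) * norm (y - x) ^ 3"
        using r by (intro mult_right_mono) auto
      finally show ?thesis .
    next
      case False
      then have "r ^ 3 \<le> norm (y - x) ^ 3"
        using r by (intro power_mono) (auto simp: dist_norm norm_minus_commute)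
      then have "\<bar>b\<bar> \<le> \<bar>b\<bar> / r ^ 3 * norm (y - x) ^ 3"
        using r mult_left_mono[of "r ^ 3" "norm (y - x) ^ 3" "\<bar>b\<bar> / r ^ 3"] by simp
      also have "\<dots> \<le> (C + \<bar>b\<bar> / r ^ 3) * norm (y - x) ^ 3"
        using \<open>0 \<le> C\<close> by (intro mult_right_mono) auto
      finally show ?thesis using b[OF xy] by linarith
    qed
  qed
qed

lemma bounded_matrix_field:
  fixes H :: "'a::topological_space \<Rightarrow> real^'n^'m"
  assumes "compact K" "continuous_on K H"
  obtains B where "0 \<le> B" "\<And>x v. x \<in> K \<Longrightarrow> norm (H x *v v) \<le> B * norm v"
proof -
  have "bounded (H ` K)"
    using assms by (intro compact_imp_bounded compact_continuous_image)
  then obtain b where b: "\<And>x. x \<in> K \<Longrightarrow> norm (H x) \<le> b" by (auto simp: bounded_iff)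
  show thesis
  proof (rule that[of "real CARD('m) * real CARD('n) * \<bar>b\<bar>"])
    fix x and v :: "real^'n" assume "x \<in> K"
    have ent: "\<bar>H x $ i $ j\<bar> \<le> \<bar>b\<bar>" for i j
      using component_le_norm_cart[of "H x $ i" j] Finite_Cartesian_Product.norm_nth_le[of "H x" i] b[OF \<open>x \<in> K\<close>] by linarith
    have "norm (H x *v v) \<le> onorm ((*v) (H x)) * norm v" by (rule onorm) simp
    also have "\<dots> \<le> real CARD('m) * real CARD('n) * \<bar>b\<bar> * norm v"
      by (intro mult_right_mono onorm_le_matrix_component ent) auto
    finally show "norm (H x *v v) \<le> real CARD('m) * real CARD('n) * \<bar>b\<bar> * norm v" .
  qed auto
qed

text \<open>On a bounded set the third power of the distance is dominated by its square.\<close>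

lemma taylor_first_order_on_closure:
  fixes \<phi> :: "real^'n \<Rightarrow> real" and G :: "real^'n \<Rightarrow> real^'n" and H :: "real^'n \<Rightarrow> real^'n^'n"
  assumes "bounded \<Omega>" and cH: "continuous_on (closure \<Omega>) H"
    and T: "\<And>x y. x \<in> closure \<Omega> \<Longrightarrow> y \<in> closure \<Omega> \<Longrightarrow> \<bar>taylor_remainder \<phi> G H x y\<bar> \<le> C * norm (y - x) ^ 3"
    and "0 \<le> C"
  obtains C' where "0 \<le> C'"
    "\<And>x y. x \<in> closure \<Omega> \<Longrightarrow> y \<in> closure \<Omega> \<Longrightarrow> \<bar>\<phi> y - \<phi> x - G x \<bullet> (y - x)\<bar> \<le> C' * norm (y - x) ^ 2"
proof -
  have cpt: "compact (closure \<Omega>)" using \<open>bounded \<Omega>\<close> by simp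
  obtain B where B: "0 \<le> B" "\<And>x v. x \<in> closure \<Omega> \<Longrightarrow> norm (H x *v v) \<le> B * norm v"
    using bounded_matrix_field[OF cpt cH] by metis
  let ?D = "diameter (closure \<Omega>)"
  have D: "0 \<le> ?D" using cpt by (simp add: compact_imp_bounded diameter_ge_0)
  show thesis
  proof (rule that[of "C * ?D + B"])
    show "0 \<le> C * ?D + B" using \<open>0 \<le> C\<close> D B by simp
    fix x y assume xy: "x \<in> closure \<Omega>" "y \<in> closure \<Omega>"
    let ?h = "y - x"
    have "norm ?h \<le> ?D"
      using diameter_bounded_bound[OF compact_imp_bounded[OF cpt] xy] by (simp add: dist_norm norm_minus_commute)
    then have "C * norm ?h ^ 3 \<le> C * ?D * norm ?h ^ 2"
      using \<open>0 \<le> C\<close> mult_right_mono[of "norm ?h" ?D "C * norm ?h ^ 2"]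
      by (simp add: power3_eq_cube power2_eq_square ac_simps)
    moreover have "\<bar>?h \<bullet> (H x *v ?h)\<bar> \<le> B * norm ?h ^ 2"
    proof -
      have "\<bar>?h \<bullet> (H x *v ?h)\<bar> \<le> norm ?h * norm (H x *v ?h)" by (rule Cauchy_Schwarz_ineq2)
      also have "\<dots> \<le> norm ?h * (B * norm ?h)" by (intro mult_left_mono B xy) simp
      finally show ?thesis by (simp add: power2_eq_square ac_simps)
    qed
    moreover have "\<phi> y - \<phi> x - G x \<bullet> ?h = taylor_remainder \<phi> G H x y + 1/2 * (?h \<bullet> (H x *v ?h))"
      by (simp add: taylor_remainder_def)
    ultimately show "\<bar>\<phi> y - \<phi> x - G x \<bullet> ?h\<bar> \<le> (C * ?D + B) * norm ?h ^ 2"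
      using T[OF xy] by (simp add: distrib_right)
  qed
qed

section \<open>The interpolation error\<close>

text \<open>The mesh vertices are also vertices of the exact triangulation, whose elements cover the closure.\<close>

lemma vertices_subset_closure:
  assumes "exactly_triangulated \<Omega> m"
  shows "vertices m \<subseteq> closure \<Omega>"
proof
  fix v assume "v \<in> vertices m"
  then obtain T where T: "T \<in> elems m" "v extreme_point_of T" by (auto simp: vertices_def)
  then obtain F F' where "homeomorphism T (curved m T) F F'" "F v = v"
    using assms unfolding exactly_triangulated_def by metis
  moreover have "v \<in> T" using T by (simp add: extreme_point_of_def)
  ultimately have "v \<in> curved m T" by (metis homeomorphism_image1 imageI)
  then show "v \<in> closure \<Omega>" using assms T unfolding exactly_triangulated_def by blast
qed

text \<open>On a simplex the basis functions are affine and take the values 0 and 1 at the vertices, so that they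
  are the barycentric coordinates of the projected point.\<close>

lemma interp_convex_combination:
  assumes tri: "triangulated \<Omega> \<delta> \<Delta>x m" and P1: "is_p1basis m"
    and T: "T \<in> elems m" and q: "meshproj m x \<in> T"
  obtains W u where "finite W" "W \<subseteq> vertices m \<inter> T" "\<And>v. v \<in> W \<Longrightarrow> 0 \<le> u v" "sum u W = 1"
    "(\<Sum>v\<in>W. u v *\<^sub>R v) = meshproj m x" "interp m \<Phi> x = (\<Sum>v\<in>W. u v * \<Phi> v)"
proof -
  let ?q = "meshproj m x"
  have "int CARD('a) simplex T" using tri T by (simp add: triangulated_def)
  then obtain W where W: "finite W" "\<not> affine_dependent W" "T = convex hull W"
    unfolding simplex by blast
  have WT: "W \<subseteq> vertices m \<inter> T"
  proof
    fix v assume v: "v \<in> W"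
    then have "v extreme_point_of T"
      unfolding W(3) using extreme_point_of_convex_hull_affine_independent[OF W(2)] by blast
    then show "v \<in> vertices m \<inter> T" using T v W(3) by (auto simp: vertices_def intro: hull_inc)
  qed
  obtain u where u: "\<And>v. v \<in> W \<Longrightarrow> 0 \<le> u v" "sum u W = 1" "(\<Sum>v\<in>W. u v *\<^sub>R v) = ?q"
    using q unfolding W(3) convex_hull_finite[OF W(1)] by auto
  have bij: "bij_betw (vert m) (indices m) (vertices m)" using tri by (simp add: triangulated_def)
  have fin: "finite (indices m)" by (simp add: indices_def)
  have aff: "p1basis m i ?q = (\<Sum>v\<in>W. u v * p1basis m i v)" if i: "i \<in> indices m" for i
  proof -
    obtain c a where ca: "\<And>z. z \<in> T \<Longrightarrow> p1basis m i z = c + a \<bullet> z"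
      using P1 i T unfolding is_p1basis_def by meson
    have "(\<Sum>v\<in>W. u v * p1basis m i v) = (\<Sum>v\<in>W. u v * c + a \<bullet> (u v *\<^sub>R v))"
      using ca WT by (intro sum.cong) (auto simp: distrib_left)
    also have "\<dots> = sum u W * c + a \<bullet> (\<Sum>v\<in>W. u v *\<^sub>R v)"
      by (simp add: sum.distrib sum_distrib_right inner_sum_right)
    also have "\<dots> = p1basis m i ?q" using u ca[OF q] by simp
    finally show ?thesis by simp
  qed
  have val: "(\<Sum>i\<in>indices m. p1basis m i v * \<Phi> (vert m i)) = \<Phi> v" if v: "v \<in> W" for v
  proof -
    obtain j where j: "j \<in> indices m" "v = vert m j"
      using v WT bij_betw_imp_surj_on[OF bij] by blast
    have "(\<Sum>i\<in>indices m. p1basis m i v * \<Phi> (vert m i))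
        = (\<Sum>i\<in>indices m. if i = j then \<Phi> (vert m i) else 0)"
      using P1 j by (intro sum.cong) (auto simp: is_p1basis_def)
    then show ?thesis using fin j by (simp add: sum.delta)
  qed
  have "interp m \<Phi> x = (\<Sum>i\<in>indices m. \<Sum>v\<in>W. u v * (p1basis m i v * \<Phi> (vert m i)))"
    unfolding interp_def by (intro sum.cong) (auto simp: aff sum_distrib_right mult.assoc)
  also have "\<dots> = (\<Sum>v\<in>W. u v * (\<Sum>i\<in>indices m. p1basis m i v * \<Phi> (vert m i)))"
    by (subst sum.swap) (simp add: sum_distrib_left)
  also have "\<dots> = (\<Sum>v\<in>W. u v * \<Phi> v)" using val by (intro sum.cong) auto
  finally show thesis using that W(1) WT u by blast
qed

text \<open>With \<open>q\<close> the projection of \<open>x\<close>, the linear terms \<open>G q \<bullet> (v - q)\<close> cancel in the convex combination of the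
  vertices \<open>v\<close>, because its barycentre is \<open>q\<close>. The expansion can be made at \<open>q\<close> since \<open>q\<close> lies in the
  closure of the domain.\<close>

lemma interp_error_at_projection:
  fixes \<phi> :: "real^'n \<Rightarrow> real" and G :: "real^'n \<Rightarrow> real^'n"
  assumes tri: "triangulated \<Omega> \<delta> \<Delta>x m" and ex: "exactly_triangulated \<Omega> m"
    and mp: "mesh_projection \<Omega> m" and P1: "is_p1basis m" and x: "x \<in> closure \<Omega>"
    and C: "\<And>p y. p \<in> closure \<Omega> \<Longrightarrow> y \<in> closure \<Omega> \<Longrightarrow> \<bar>\<phi> y - \<phi> p - G p \<bullet> (y - p)\<bar> \<le> C * norm (y - p) ^ 2"
    and "0 \<le> C"
  shows "\<bar>interp m (restrict \<phi> (vertices m)) x - \<phi> (meshproj m x)\<bar> \<le> C * \<Delta>x\<^sup>2"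
proof -
  let ?q = "meshproj m x"
  obtain T where T: "T \<in> elems m" "?q = closest_point T x" and q: "?q \<in> closure \<Omega>"
    using mp x unfolding mesh_projection_def by blast
  have "int CARD('n) simplex T" using tri T by (simp add: triangulated_def)
  then have cT: "compact T" and "T \<noteq> {}"
    by (auto simp: simplex intro: finite_imp_compact_convex_hull)
  then have qT: "?q \<in> T" using T closest_point_in_set[of T x] by (simp add: compact_imp_closed)
  obtain W u where W: "finite W" "W \<subseteq> vertices m \<inter> T" and u: "\<And>v. v \<in> W \<Longrightarrow> 0 \<le> u v" "sum u W = 1"
    "(\<Sum>v\<in>W. u v *\<^sub>R v) = ?q" and I: "interp m (restrict \<phi> (vertices m)) x = (\<Sum>v\<in>W. u v * restrict \<phi> (vertices m) v)"
  proof (rule interp_convex_combination[OF tri P1 T(1) qT, of "restrict \<phi> (vertices m)"])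
  qed (rule that)
  have diam: "norm (v - ?q) \<le> \<Delta>x" if "v \<in> W" for v
  proof -
    have "norm (v - ?q) \<le> diameter T"
      using diameter_bounded_bound[OF compact_imp_bounded[OF cT], of v ?q] that W qT
      unfolding dist_norm by blast
    also have "\<dots> \<le> \<Delta>x"
    proof -
      have "finite (diameter ` elems m)" and dx: "\<Delta>x = Max (diameter ` elems m)"
        using tri by (simp_all add: triangulated_def triangulation_def)
      then show ?thesis unfolding dx using T by (intro Max_ge) auto
    qed
    finally show ?thesis .
  qed
  have "(\<Sum>v\<in>W. u v * (\<phi> v - \<phi> ?q - G ?q \<bullet> (v - ?q)))
      = (\<Sum>v\<in>W. u v * \<phi> v - u v * (\<phi> ?q - G ?q \<bullet> ?q) - G ?q \<bullet> (u v *\<^sub>R v))"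
    by (intro sum.cong) (simp_all add: inner_diff_right right_diff_distrib)
  also have "\<dots> = (\<Sum>v\<in>W. u v * \<phi> v) - sum u W * (\<phi> ?q - G ?q \<bullet> ?q) - G ?q \<bullet> (\<Sum>v\<in>W. u v *\<^sub>R v)"
    by (simp only: sum_subtractf sum_distrib_right inner_sum_right)
  also have "(\<Sum>v\<in>W. u v * \<phi> v) = interp m (restrict \<phi> (vertices m)) x"
    unfolding I using W by (intro sum.cong) auto
  finally have "\<bar>interp m (restrict \<phi> (vertices m)) x - \<phi> ?q\<bar>
      = \<bar>\<Sum>v\<in>W. u v * (\<phi> v - \<phi> ?q - G ?q \<bullet> (v - ?q))\<bar>"
    using u by simp
  also have "\<dots> \<le> (\<Sum>v\<in>W. u v * (C * \<Delta>x\<^sup>2))"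
  proof (rule order_trans[OF sum_abs], rule sum_mono)
    fix v assume v: "v \<in> W"
    have "\<bar>\<phi> v - \<phi> ?q - G ?q \<bullet> (v - ?q)\<bar> \<le> C * norm (v - ?q) ^ 2"
      using v W vertices_subset_closure[OF ex] q by (intro C) auto
    also have "\<dots> \<le> C * \<Delta>x\<^sup>2"
      using diam[OF v] \<open>0 \<le> C\<close> by (intro mult_left_mono power_mono) auto
    finally show "\<bar>u v * (\<phi> v - \<phi> ?q - G ?q \<bullet> (v - ?q))\<bar> \<le> u v * (C * \<Delta>x\<^sup>2)"
      using u(1)[OF v] by (simp add: abs_mult mult_left_mono)
  qed
  also have "\<dots> = C * \<Delta>x\<^sup>2" by (simp add: sum_distrib_right[symmetric] u)
  finally show ?thesis .
qed

text \<open>The projection moves a point by \<open>O(\<Delta>x\<^sup>2)\<close> only, and \<open>\<phi>\<close> is Lipschitz.\<close>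

lemma interp_error:
  fixes \<phi> :: "real^'n \<Rightarrow> real" and G :: "real^'n \<Rightarrow> real^'n"
  assumes "bounded \<Omega>" and mesh: "mesh_family \<Omega> sizes mesh" and cG: "continuous_on (closure \<Omega>) G"
    and C: "\<And>p y. p \<in> closure \<Omega> \<Longrightarrow> y \<in> closure \<Omega> \<Longrightarrow> \<bar>\<phi> y - \<phi> p - G p \<bullet> (y - p)\<bar> \<le> C * norm (y - p) ^ 2"
    and "0 \<le> C"
  obtains C' where "0 \<le> C'"
    "\<And>\<Delta>x x. \<Delta>x \<in> sizes \<Longrightarrow> x \<in> closure \<Omega> \<Longrightarrow>
       \<bar>interp (mesh \<Delta>x) (restrict \<phi> (vertices (mesh \<Delta>x))) x - \<phi> x\<bar> \<le> C' * \<Delta>x\<^sup>2"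
proof -
  have cpt: "compact (closure \<Omega>)" using \<open>bounded \<Omega>\<close> by simp
  have "bounded (G ` closure \<Omega>)"
    by (intro compact_imp_bounded compact_continuous_image cG cpt)
  then obtain b where b: "\<And>x. x \<in> closure \<Omega> \<Longrightarrow> norm (G x) \<le> b" by (auto simp: bounded_iff)
  obtain c where c: "0 < c"
    "\<And>\<Delta>x x. \<Delta>x \<in> sizes \<Longrightarrow> x \<in> closure \<Omega> \<Longrightarrow> norm (x - meshproj (mesh \<Delta>x) x) \<le> c * \<Delta>x\<^sup>2"
    using mesh unfolding mesh_family_def by metis
  obtain \<delta> where tri: "\<And>\<Delta>x. \<Delta>x \<in> sizes \<Longrightarrow> triangulated \<Omega> \<delta> \<Delta>x (mesh \<Delta>x)"
    using mesh unfolding mesh_family_def by metis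
  let ?D = "diameter (closure \<Omega>)"
  have D: "0 \<le> ?D" using cpt by (simp add: compact_imp_bounded diameter_ge_0)
  show thesis
  proof (rule that[of "C + (\<bar>b\<bar> + C * ?D) * c"])
    show "0 \<le> C + (\<bar>b\<bar> + C * ?D) * c" using \<open>0 \<le> C\<close> D c by simp
    fix \<Delta>x x assume dx: "\<Delta>x \<in> sizes" and x: "x \<in> closure \<Omega>"
    let ?m = "mesh \<Delta>x"
    let ?q = "meshproj ?m x"
    have m: "exactly_triangulated \<Omega> ?m" "mesh_projection \<Omega> ?m" "is_p1basis ?m"
      using mesh dx by (auto simp: mesh_family_def)
    have q: "?q \<in> closure \<Omega>" using m(2) x by (auto simp: mesh_projection_def)
    have near: "norm (?q - x) \<le> c * \<Delta>x\<^sup>2" using c(2)[OF dx x] by (simp add: norm_minus_commute)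
    have "norm (?q - x) \<le> ?D"
      using diameter_bounded_bound[OF compact_imp_bounded[OF cpt] q x] by (simp add: dist_norm)
    then have sq: "C * norm (?q - x) ^ 2 \<le> C * ?D * norm (?q - x)"
      using \<open>0 \<le> C\<close> mult_left_mono[of "norm (?q - x)" ?D "C * norm (?q - x)"]
      by (simp add: power2_eq_square ac_simps)
    have "\<bar>G x \<bullet> (?q - x)\<bar> \<le> norm (G x) * norm (?q - x)" by (rule Cauchy_Schwarz_ineq2)
    also have "\<dots> \<le> \<bar>b\<bar> * norm (?q - x)" using b[OF x] by (intro mult_right_mono) auto
    finally have "\<bar>\<phi> ?q - \<phi> x\<bar> \<le> (\<bar>b\<bar> + C * ?D) * norm (?q - x)"
      using C[OF x q] sq by (simp add: distrib_right)
    also have "\<dots> \<le> (\<bar>b\<bar> + C * ?D) * (c * \<Delta>x\<^sup>2)"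
      using near D \<open>0 \<le> C\<close> by (intro mult_left_mono) auto
    finally show "\<bar>interp ?m (restrict \<phi> (vertices ?m)) x - \<phi> x\<bar> \<le> (C + (\<bar>b\<bar> + C * ?D) * c) * \<Delta>x\<^sup>2"
      using interp_error_at_projection[OF tri[OF dx] m x C \<open>0 \<le> C\<close>]
      by (simp add: distrib_right mult.assoc)
  qed
qed

section \<open>The oblique distance to the boundary\<close>

text \<open>The oblique distance is of class \<open>C\<^sup>1\<close> and vanishes on the boundary; compactness of the boundary and
  of the control set make its local Lipschitz constants uniform.\<close>

lemma oblique_distance_Lipschitz_near_boundary:
  fixes P :: "('n::finite, 'na::finite, 'nb::finite, 's::finite) problem"
  assumes cF: "compact (frontier (region P))" and cB: "compact (ctrlB P)" and "0 < R"
    and obl: "oblique_projection P R p d"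
  obtains r L where "0 < r" "0 \<le> L"
    "\<And>z y b. z \<in> frontier (region P) \<Longrightarrow> infdist y (frontier (region P)) < R \<Longrightarrow> b \<in> ctrlB P \<Longrightarrow>
       dist z y < r \<Longrightarrow> \<bar>d b y\<bar> \<le> L * dist z y"
proof -
  let ?F = "frontier (region P)"
  define S where "S = {x. infdist x ?F < R}"
  have d: "Ck_on_set 1 (\<lambda>(x, b). d b x) (S \<times> ctrlB P)"
    and d0: "\<And>x b. x \<in> ?F \<Longrightarrow> b \<in> ctrlB P \<Longrightarrow> d b x = 0"
    using obl by (auto simp: oblique_projection_def Let_def S_def)
  have FS: "z \<in> S" if "z \<in> ?F" for z using that \<open>0 < R\<close> by (simp add: S_def)
  define Q where "Q = (\<lambda>(z, b) (y, b') C. z \<in> ?F \<longrightarrow> y \<in> S \<longrightarrow> b \<in> ctrlB P \<longrightarrow> b' = b \<longrightarrow>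
      \<bar>d b y\<bar> \<le> C * dist z (y :: real^'n))"
  have cpt: "compact (?F \<times> ctrlB P)" using cF cB by (rule compact_Times)
  obtain r L where rL: "0 < r" "0 \<le> L" "\<And>u w. u \<in> ?F \<times> ctrlB P \<Longrightarrow> dist u w < r \<Longrightarrow> Q u w L"
  proof (rule compact_uniform_local_bound[OF cpt, of Q])
    show "Q u w C'" if "Q u w C" "C \<le> C'" for u w C C'
      using that mult_right_mono[OF \<open>C \<le> C'\<close>, of "dist (fst u) (fst w)"]
      by (auto simp: Q_def split: prod.splits)
    fix w assume w: "w \<in> ?F \<times> ctrlB P"
    then have "w \<in> S \<times> ctrlB P" using FS by auto
    then obtain U f where U: "open U" "w \<in> U" and f: "Ck_on (Suc 0) f U"
      and fd: "\<And>v. v \<in> (S \<times> ctrlB P) \<inter> U \<Longrightarrow> f v = (case v of (x, b) \<Rightarrow> d b x)"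
      using d unfolding Ck_on_set_def One_nat_def by meson
    obtain e where e: "0 < e" "cball w e \<subseteq> U" using U open_contains_cball by blast
    obtain B where B: "\<And>x y. x \<in> cball w e \<Longrightarrow> y \<in> cball w e \<Longrightarrow> norm (f x - f y) \<le> B * norm (x - y)"
      using Ck_on_Lipschitz_on_compact_convex[OF f compact_cball convex_cball e(2)] by metis
    have "Q u v B" if u: "u \<in> ball w e" and v: "v \<in> ball w e" for u v
    proof -
      obtain z b y b' where uv: "u = (z, b)" "v = (y, b')" by (meson surj_pair)
      have "\<bar>d b y\<bar> \<le> B * dist z y" if "z \<in> ?F" "y \<in> S" "b \<in> ctrlB P" "b' = b"
      proof -
        have in_U: "u \<in> U" "v \<in> U" using u v e by auto
        have "f v = d b y" "f u = 0"
          using fd[of u] fd[of v] in_U that FS[of z] d0[of z b] by (auto simp: uv)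
        then have "\<bar>d b y\<bar> \<le> B * norm (v - u)" using B[of v u] u v by auto
        then show ?thesis
          using that by (simp add: uv norm_Pair dist_norm norm_minus_commute)
      qed
      then show ?thesis by (simp add: Q_def uv)
    qed
    then show "\<exists>V C. open V \<and> w \<in> V \<and> (\<forall>x\<in>V. \<forall>y\<in>V. Q x y C)"
      using e by (intro exI[of _ "ball w e"] exI[of _ B]) auto
  qed blast
  show thesis
  proof (rule that[OF rL(1,2)])
    fix z y b assume *: "z \<in> ?F" "infdist y ?F < R" "b \<in> ctrlB P" "dist z y < r"
    then have "dist (z, b) (y, b) < r" by (simp add: dist_Pair_Pair)
    then have "Q (z, b) (y, b) L" using rL(3)[of "(z, b)"] * by simp
    then show "\<bar>d b y\<bar> \<le> L * dist z y" using * by (simp add: Q_def S_def)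
  qed
qed

text \<open>The segment from \<open>x\<close> to the exterior point \<open>y\<close> meets the boundary in a point \<open>z\<close> where the oblique distance
  vanishes. If \<open>z\<close> is close to \<open>y\<close>, the Lipschitz estimate applies. Otherwise \<open>norm (y - x)\<close> is
  bounded below, while \<open>\<bar>d b y\<bar>\<close>, the length of \<open>y - p b y\<close>, is at most \<open>norm (y - x)\<close> plus the
  diameter of the domain.\<close>

lemma oblique_distance_bound:
  fixes P :: "('n::finite, 'na::finite, 'nb::finite, 's::finite) problem"
  assumes bnd: "bounded (region P)" and cB: "compact (ctrlB P)" and "0 < R"
    and obl: "oblique_projection P R p d"
    and unit: "\<And>x b. x \<in> frontier (region P) \<Longrightarrow> b \<in> ctrlB P \<Longrightarrow> norm (gam P b x) = 1"
  obtains L where "0 \<le> L"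
    "\<And>x y b. x \<in> closure (region P) \<Longrightarrow> y \<notin> closure (region P) \<Longrightarrow>
       infdist y (frontier (region P)) < R \<Longrightarrow> b \<in> ctrlB P \<Longrightarrow> \<bar>d b y\<bar> \<le> L * norm (y - x)"
proof -
  let ?\<Omega> = "region P"
  let ?F = "frontier ?\<Omega>"
  have cpt: "compact (closure ?\<Omega>)" using bnd by simp
  have Fsub: "?F \<subseteq> closure ?\<Omega>" by (simp add: frontier_def)
  have cF: "compact ?F" using bnd by (simp add: compact_frontier_bounded)
  obtain r L where rL: "0 < r" "0 \<le> L"
    "\<And>z y b. z \<in> ?F \<Longrightarrow> infdist y ?F < R \<Longrightarrow> b \<in> ctrlB P \<Longrightarrow> dist z y < r \<Longrightarrow> \<bar>d b y\<bar> \<le> L * dist z y"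
    using oblique_distance_Lipschitz_near_boundary[OF cF cB \<open>0 < R\<close> obl] by blast
  let ?D = "diameter (closure ?\<Omega>)"
  have D: "0 \<le> ?D" using cpt by (simp add: compact_imp_bounded diameter_ge_0)
  show thesis
  proof (rule that[of "L + (1 + ?D / r)"])
    show "0 \<le> L + (1 + ?D / r)" using rL D by simp
    fix x y b assume x: "x \<in> closure ?\<Omega>" and y: "y \<notin> closure ?\<Omega>" and yR: "infdist y ?F < R"
      and b: "b \<in> ctrlB P"
    have "closed_segment x y \<inter> frontier (closure ?\<Omega>) \<noteq> {}"
      by (rule connected_Int_frontier) (use x y in auto)
    then obtain z where z: "z \<in> closed_segment x y" "z \<in> ?F"
      using interior_mono[OF closure_subset[of ?\<Omega>]] by (auto simp: frontier_def)
    have zy: "dist z y \<le> norm (y - x)"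
      using segment_bound(2)[OF z(1)] by (simp add: dist_norm norm_minus_commute)
    show "\<bar>d b y\<bar> \<le> (L + (1 + ?D / r)) * norm (y - x)"
    proof (cases "dist z y < r")
      case True
      then have "\<bar>d b y\<bar> \<le> L * dist z y" using rL(3) z yR b by blast
      also have "\<dots> \<le> (L + (1 + ?D / r)) * norm (y - x)"
        using zy rL D by (intro mult_mono) auto
      finally show ?thesis .
    next
      case False
      let ?p = "p b y"
      have p: "?p \<in> ?F" "y = ?p + d b y *\<^sub>R gam P b ?p"
        using obl yR b by (auto simp: oblique_projection_def Let_def)
      have "d b y *\<^sub>R gam P b ?p = (y - x) + (x - ?p)" using p(2) by (simp add: algebra_simps)
      then have "\<bar>d b y\<bar> = norm ((y - x) + (x - ?p))"
        using unit[OF p(1) b] by (metis mult.right_neutral norm_scaleR)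
      also have "\<dots> \<le> norm (y - x) + ?D"
        using norm_triangle_ineq[of "y - x" "x - ?p"]
          diameter_bounded_bound[OF compact_imp_bounded[OF cpt] x, of ?p] p Fsub
        by (auto simp: dist_norm)
      also have "?D \<le> ?D / r * norm (y - x)"
        using False zy rL D mult_left_mono[of r "norm (y - x)" "?D / r"] by simp
      finally have "\<bar>d b y\<bar> \<le> (1 + ?D / r) * norm (y - x)" by (simp add: distrib_right)
      also have "\<dots> \<le> (L + (1 + ?D / r)) * norm (y - x)"
        using rL by (intro mult_right_mono) auto
      finally show ?thesis .
    qed
  qed
qed

section \<open>Infima and averages over the discrete walk\<close>

text \<open>Passing from the pointwise expansion to the infimum over the controls. The bound on \<open>X\<close> makes both
  the supremum and the infimum meaningful: in the reals they are unspecified for unbounded sets.\<close>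

lemma INF_plus_SUP_error:
  fixes f X :: "'a \<Rightarrow> real"
  assumes "I \<noteq> {}" and err: "\<And>p. p \<in> I \<Longrightarrow> \<bar>f p - c + X p\<bar> \<le> E"
    and bd: "\<And>p. p \<in> I \<Longrightarrow> \<bar>X p\<bar> \<le> b"
  shows "\<bar>(INF p\<in>I. f p) - c + (SUP p\<in>I. X p)\<bar> \<le> E"
proof -
  have X: "bdd_above (X ` I)"
    by (rule bdd_aboveI2[of _ _ b]) (use bd in \<open>fastforce simp: abs_le_iff\<close>)
  have "c - b - E \<le> f p" if "p \<in> I" for p using err[OF that] bd[OF that] by linarith
  then have f: "bdd_below (f ` I)" by (rule bdd_belowI2)
  have "c - (SUP p\<in>I. X p) - E \<le> (INF p\<in>I. f p)"
  proof (rule cINF_greatest[OF \<open>I \<noteq> {}\<close>])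
    fix p assume "p \<in> I"
    then show "c - (SUP p\<in>I. X p) - E \<le> f p" using err[of p] cSUP_upper[OF _ X, of p] by linarith
  qed
  moreover have "(SUP p\<in>I. X p) \<le> E + c - (INF p\<in>I. f p)"
  proof (rule cSUP_least[OF \<open>I \<noteq> {}\<close>])
    fix p assume "p \<in> I"
    then show "X p \<le> E + c - (INF p\<in>I. f p)" using err[of p] cINF_lower[OF f, of p] by linarith
  qed
  ultimately show ?thesis by linarith
qed

lemma trace_conjugate_eq_sum_columns:
  fixes S :: "real^'s^'n" and M :: "real^'n^'n"
  shows "trace (S ** transpose S ** M) = (\<Sum>j\<in>UNIV. column j S \<bullet> (M *v column j S))"
proof -
  have "trace (S ** transpose S ** M) = (\<Sum>i\<in>UNIV. \<Sum>k\<in>UNIV. \<Sum>j\<in>UNIV. S $ i $ j * S $ k $ j * M $ k $ i)"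
    by (simp add: trace_def matrix_matrix_mult_def transpose_def sum_distrib_right)
  also have "\<dots> = (\<Sum>i\<in>UNIV. \<Sum>j\<in>UNIV. \<Sum>k\<in>UNIV. S $ i $ j * S $ k $ j * M $ k $ i)"
    by (intro sum.cong refl sum.swap)
  also have "\<dots> = (\<Sum>j\<in>UNIV. \<Sum>i\<in>UNIV. \<Sum>k\<in>UNIV. S $ i $ j * S $ k $ j * M $ k $ i)"
    by (rule sum.swap)
  also have "\<dots> = (\<Sum>j\<in>UNIV. \<Sum>k\<in>UNIV. \<Sum>i\<in>UNIV. S $ i $ j * S $ k $ j * M $ k $ i)"
    by (intro sum.cong refl sum.swap)
  also have "\<dots> = (\<Sum>j\<in>UNIV. column j S \<bullet> (M *v column j S))"
    by (simp add: inner_vec_def matrix_vector_mult_def column_def sum_distrib_left ac_simps)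
  finally show ?thesis .
qed

text \<open>The two signs cancel all terms that are linear in the columns of \<open>S\<close>, and the terms that are quadratic
  in them add up to the trace. The drift contributes the quadratic term of order \<open>\<Delta>t\<^sup>2\<close>.\<close>

lemma symmetric_walk_second_order_sum:
  fixes S :: "real^'s::finite^'n::finite" and M :: "real^'n^'n" and g \<mu> :: "real^'n"
  assumes "0 \<le> \<Delta>t"
  defines "h \<equiv> \<lambda>s :: bool \<times> 's. \<Delta>t *\<^sub>R \<mu>
      + ((if fst s then 1 else - 1) * sqrt (real CARD('s) * \<Delta>t)) *\<^sub>R column (snd s) S"
  shows "1 / (2 * real CARD('s)) * (\<Sum>s\<in>UNIV. g \<bullet> h s + 1/2 * (h s \<bullet> (M *v h s)))
    = \<Delta>t * (\<mu> \<bullet> g) + 1/2 * \<Delta>t\<^sup>2 * (\<mu> \<bullet> (M *v \<mu>)) + 1/2 * \<Delta>t * trace (S ** transpose S ** M)"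
proof -
  let ?N = "real CARD('s)"
  let ?c = "sqrt (?N * \<Delta>t)"
  have cc: "?c * ?c = ?N * \<Delta>t" using \<open>0 \<le> \<Delta>t\<close> by simp
  have pair: "(g \<bullet> h (True, j) + 1/2 * (h (True, j) \<bullet> (M *v h (True, j))))
      + (g \<bullet> h (False, j) + 1/2 * (h (False, j) \<bullet> (M *v h (False, j))))
    = 2 * \<Delta>t * (\<mu> \<bullet> g) + \<Delta>t\<^sup>2 * (\<mu> \<bullet> (M *v \<mu>)) + ?N * \<Delta>t * (column j S \<bullet> (M *v column j S))" for j
  proof -
    have "(g \<bullet> (u + c *\<^sub>R w) + 1/2 * ((u + c *\<^sub>R w) \<bullet> (M *v (u + c *\<^sub>R w))))
      + (g \<bullet> (u + (- c) *\<^sub>R w) + 1/2 * ((u + (- c) *\<^sub>R w) \<bullet> (M *v (u + (- c) *\<^sub>R w))))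
      = 2 * (u \<bullet> g) + u \<bullet> (M *v u) + (c * c) * (w \<bullet> (M *v w))" for u w c
      by (simp add: inner_add_left inner_add_right inner_diff_left inner_diff_right
          matrix_vector_right_distrib matrix_vector_mult_diff_distrib
          matrix_vector_mult_scaleR inner_commute[of g] algebra_simps)
    from this[of "\<Delta>t *\<^sub>R \<mu>" ?c "column j S"] show ?thesis
      unfolding h_def cc by (simp add: matrix_vector_mult_scaleR power2_eq_square)
  qed
  have "(\<Sum>s\<in>UNIV. g \<bullet> h s + 1/2 * (h s \<bullet> (M *v h s)))
      = (\<Sum>j\<in>UNIV. \<Sum>e\<in>UNIV. g \<bullet> h (e, j) + 1/2 * (h (e, j) \<bullet> (M *v h (e, j))))"
    by (subst sum.swap) (simp add: sum.cartesian_product UNIV_Times_UNIV[symmetric] case_prod_beta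
        del: UNIV_Times_UNIV)
  also have "\<dots> = (\<Sum>j\<in>UNIV. 2 * \<Delta>t * (\<mu> \<bullet> g) + \<Delta>t\<^sup>2 * (\<mu> \<bullet> (M *v \<mu>))
      + ?N * \<Delta>t * (column j S \<bullet> (M *v column j S)))"
    using pair by (intro sum.cong) (simp_all add: UNIV_bool add.commute)
  also have "\<dots> = ?N * (2 * \<Delta>t * (\<mu> \<bullet> g) + \<Delta>t\<^sup>2 * (\<mu> \<bullet> (M *v \<mu>)))
      + ?N * \<Delta>t * trace (S ** transpose S ** M)"
    by (simp add: sum.distrib trace_conjugate_eq_sum_columns sum_distrib_left)
  finally show ?thesis by (simp add: field_simps)
qed

section \<open>Consistency of the scheme\<close>

text \<open>The second order term of the expansion at a reflected point is half the Hessian form at \<open>h - d *\<^sub>R v\<close>,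
  with \<open>h\<close> the step of the walk, \<open>v\<close> the direction of reflection and \<open>d\<close> the value of \<open>dtil\<close>. All its terms
  other than the one in \<open>h\<close> alone contain the factor \<open>d\<close>; their cofactor is of order \<open>sqrt \<Delta>t\<close>, as \<open>h\<close> and \<open>d\<close>
  are, and is divided by \<open>sqrt \<Delta>t\<close>.\<close>

definition boundary_correction ::
  "('n::finite, 'na::finite, 'nb::finite, 's::finite) problem \<Rightarrow> (real^'n \<Rightarrow> real^'n^'n) \<Rightarrow>
   'n mesh \<Rightarrow> real \<Rightarrow> nat \<Rightarrow> nat \<Rightarrow> bool \<times> 's \<Rightarrow> real^'na \<Rightarrow> real^'nb \<Rightarrow> real" where
  "boundary_correction P H m \<Delta>t k i s a b =
     (let x = vert m i; y = ypt P m \<Delta>t k i s a; h = y - x; v = gam P b (pgam P b y) in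
      if y \<in> closure (region P) then 0
      else (1/2 * dtil P m \<Delta>t k i s a b * (v \<bullet> (H x *v v))
            - 1/2 * (h \<bullet> (H x *v v) + v \<bullet> (H x *v h))) / sqrt \<Delta>t)"

lemma bounded_coefficients:
  fixes P :: "('n::finite, 'na::finite, 'nb::finite, 's::finite) problem"
  assumes std: "standing_assumptions P"
  obtains B where "0 \<le> B"
    "\<And>t x a. t \<in> {0..horizon P} \<Longrightarrow> x \<in> closure (region P) \<Longrightarrow> a \<in> ctrlA P \<Longrightarrow> norm (mu P t x a) \<le> B"
    "\<And>t x a j. t \<in> {0..horizon P} \<Longrightarrow> x \<in> closure (region P) \<Longrightarrow> a \<in> ctrlA P \<Longrightarrow>
       norm (column j (sig P t x a)) \<le> B"
    "\<And>t x a. t \<in> {0..horizon P} \<Longrightarrow> x \<in> closure (region P) \<Longrightarrow> a \<in> ctrlA P \<Longrightarrow> \<bar>runcost P t x a\<bar> \<le> B"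
    "\<And>t x b. t \<in> {0..horizon P} \<Longrightarrow> x \<in> frontier (region P) \<Longrightarrow> b \<in> ctrlB P \<Longrightarrow> \<bar>bdcost P t x b\<bar> \<le> B"
proof -
  let ?K = "{0..horizon P} \<times> closure (region P) \<times> ctrlA P"
  let ?F = "{0..horizon P} \<times> frontier (region P) \<times> ctrlB P"
  have K: "compact ?K" and F: "compact ?F"
    using std by (auto simp: standing_assumptions_def intro!: compact_Times compact_frontier_bounded)
  have bound: "\<exists>B. \<forall>z\<in>C. norm (f z) \<le> B" if "compact C" "continuous_on C f"
    for C and f :: "'x::topological_space \<Rightarrow> 'y::real_normed_vector"
    using compact_imp_bounded[OF compact_continuous_image[OF that(2,1)]] by (auto simp: bounded_iff)
  obtain b1 where b1: "\<And>t x a. (t, x, a) \<in> ?K \<Longrightarrow> norm (mu P t x a) \<le> b1"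
    using bound[OF K, of "\<lambda>(t, x, a). mu P t x a"] std by (fastforce simp: standing_assumptions_def)
  have "continuous_on ?K (\<lambda>z. column j ((\<lambda>(t, x, a). sig P t x a) z))" for j
    unfolding column_def using std
    by (intro continuous_intros) (auto simp: standing_assumptions_def)
  then have "\<exists>B. \<forall>z\<in>?K. norm (column j ((\<lambda>(t, x, a). sig P t x a) z)) \<le> B" for j
    by (rule bound[OF K])
  then obtain b2 where b2: "\<And>t x a j. (t, x, a) \<in> ?K \<Longrightarrow> norm (column j (sig P t x a)) \<le> b2 j"
    by (metis case_prod_conv)
  obtain b3 where b3: "\<And>t x a. (t, x, a) \<in> ?K \<Longrightarrow> \<bar>runcost P t x a\<bar> \<le> b3"
    using bound[OF K, of "\<lambda>(t, x, a). runcost P t x a"] std by (fastforce simp: standing_assumptions_def)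
  obtain b4 where b4: "\<And>t x b. (t, x, b) \<in> ?F \<Longrightarrow> \<bar>bdcost P t x b\<bar> \<le> b4"
    using bound[OF F, of "\<lambda>(t, x, b). bdcost P t x b"] std by (fastforce simp: standing_assumptions_def)
  have b2': "norm (column j (sig P t x a)) \<le> (\<Sum>j\<in>UNIV. \<bar>b2 j\<bar>)" if "(t, x, a) \<in> ?K" for t x a j
    using b2[OF that, of j] member_le_sum[of j UNIV "\<lambda>j. \<bar>b2 j\<bar>"] by fastforce
  have s0: "0 \<le> (\<Sum>j\<in>UNIV. \<bar>b2 j\<bar>)" by (simp add: sum_nonneg)
  define B where "B = \<bar>b1\<bar> + (\<Sum>j\<in>UNIV. \<bar>b2 j\<bar>) + \<bar>b3\<bar> + \<bar>b4\<bar>"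
  show thesis
  proof (rule that[of B])
    show "0 \<le> B" using s0 by (simp add: B_def)
    show "norm (mu P t x a) \<le> B" "norm (column j (sig P t x a)) \<le> B" "\<bar>runcost P t x a\<bar> \<le> B"
      if "t \<in> {0..horizon P}" "x \<in> closure (region P)" "a \<in> ctrlA P" for t x a j
    proof -
      have "(t, x, a) \<in> ?K" using that by simp
      from b1[OF this] b2'[OF this, of j] b3[OF this]
      show "norm (mu P t x a) \<le> B" "norm (column j (sig P t x a)) \<le> B" "\<bar>runcost P t x a\<bar> \<le> B"
        using s0 unfolding B_def by linarith+
    qed
    show "\<bar>bdcost P t x b\<bar> \<le> B"
      if "t \<in> {0..horizon P}" "x \<in> frontier (region P)" "b \<in> ctrlB P" for t x b
    proof -
      have "(t, x, b) \<in> ?F" using that by simp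
      from b4[OF this] show ?thesis using s0 unfolding B_def by linarith
    qed
  qed
qed

lemma time_step_in_horizon:
  assumes "0 < \<Delta>t" "k < num_steps P \<Delta>t"
  shows "tm \<Delta>t k \<in> {0..horizon P}"
proof -
  have "int k < \<lfloor>horizon P / \<Delta>t\<rfloor>" using assms(2) unfolding num_steps_def by linarith
  then have "real k \<le> horizon P / \<Delta>t" by linarith
  then show ?thesis using assms(1) by (simp add: tm_def field_simps)
qed

text \<open>The drift is of order \<open>\<Delta>t\<close>, hence of order \<open>sqrt \<Delta>t\<close> for bounded time steps, and the diffusion is of
  order \<open>sqrt \<Delta>t\<close>.\<close>

lemma ypt_displacement_bound:
  fixes P :: "('n::finite, 'na::finite, 'nb::finite, 's::finite) problem"
  assumes dt: "0 < \<Delta>t" "\<Delta>t \<le> \<Delta>tbar"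
    and mu: "norm (mu P (tm \<Delta>t k) (vert m i) a) \<le> B"
    and sig: "norm (column (snd s) (sig P (tm \<Delta>t k) (vert m i) a)) \<le> B"
  shows "norm (ypt P m \<Delta>t k i s a - vert m i) \<le> (sqrt \<Delta>tbar + sqrt (real CARD('s))) * B * sqrt \<Delta>t"
proof -
  let ?N = "real CARD('s)"
  let ?\<mu> = "mu P (tm \<Delta>t k) (vert m i) a"
  let ?\<sigma> = "column (snd s) (sig P (tm \<Delta>t k) (vert m i) a)"
  have B: "0 \<le> B" using mu norm_ge_zero order_trans by blast
  have "ypt P m \<Delta>t k i s a - vert m i
      = \<Delta>t *\<^sub>R ?\<mu> + ((if fst s then 1 else - 1) * sqrt (?N * \<Delta>t)) *\<^sub>R ?\<sigma>"
    by (simp add: ypt_def)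
  also have "norm \<dots> \<le> \<Delta>t * norm ?\<mu> + sqrt (?N * \<Delta>t) * norm ?\<sigma>"
    using dt by (intro order_trans[OF norm_triangle_ineq]) (auto simp: abs_mult)
  also have "\<dots> \<le> \<Delta>t * B + sqrt (?N * \<Delta>t) * B"
    using dt by (intro add_mono mult_left_mono mu sig) auto
  also have "\<Delta>t * B = sqrt \<Delta>t * (sqrt \<Delta>t * B)" using dt by simp
  also have "\<dots> \<le> sqrt \<Delta>tbar * (sqrt \<Delta>t * B)"
    using dt B by (intro mult_right_mono) auto
  finally show ?thesis by (simp add: real_sqrt_mult algebra_simps)
qed

text \<open>This form isolates the factor \<open>d\<close>, which in the scheme multiplies both the boundary operator and the
  correction.\<close>

lemma taylor_remainder_oblique_shift:
  fixes \<phi> :: "real^'n \<Rightarrow> real" and G :: "real^'n \<Rightarrow> real^'n" and H :: "real^'n \<Rightarrow> real^'n^'n"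
  shows "taylor_remainder \<phi> G H x (y - d *\<^sub>R v) = \<phi> (y - d *\<^sub>R v) - \<phi> x
    - (G x \<bullet> (y - x) + 1/2 * ((y - x) \<bullet> (H x *v (y - x)))) + d * (G x \<bullet> v)
    - d * (1/2 * d * (v \<bullet> (H x *v v)) - 1/2 * ((y - x) \<bullet> (H x *v v) + v \<bullet> (H x *v (y - x))))"
proof -
  define h where "h = y - x"
  have "y - d *\<^sub>R v - x = h - d *\<^sub>R v" by (simp add: h_def)
  then show ?thesis
    unfolding taylor_remainder_def h_def[symmetric]
    by (simp add: inner_diff_left inner_diff_right matrix_vector_mult_diff_distrib
        matrix_vector_mult_scaleR algebra_simps)
qed

text \<open>A reflected point is \<open>y - D *\<^sub>R v\<close>, where \<open>y\<close> is the unreflected point, \<open>D\<close> the oblique distance increased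
  by \<open>cbar P * sqrt \<Delta>t\<close>, and \<open>v\<close> the direction of reflection. Since \<open>D\<close> and \<open>y - x\<close> are of order \<open>sqrt \<Delta>t\<close>, the cubic
  remainder is of order \<open>\<Delta>t * sqrt \<Delta>t\<close>. The terms with the factor \<open>D\<close> are the boundary operator and, by
  definition, the correction. For a point that stays in the closure, \<open>D\<close> is zero.\<close>

lemma scheme_summand_expansion:
  fixes P :: "('n::finite, 'na::finite, 'nb::finite, 's::finite) problem"
    and \<phi> :: "real^'n \<Rightarrow> real" and G :: "real^'n \<Rightarrow> real^'n" and H :: "real^'n \<Rightarrow> real^'n^'n"
    and m :: "'n mesh" and \<Delta>t :: real and i k :: nat and s :: "bool \<times> 's" and a :: "real^'na" and b :: "real^'nb"
  defines "x \<equiv> vert m i" and "y \<equiv> ypt P m \<Delta>t k i s a"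
    and "K \<equiv> boundary_correction P H m \<Delta>t k i s a b" and "D \<equiv> dtil P m \<Delta>t k i s a b"
  assumes "0 < \<Delta>t" and x: "x \<in> closure (region P)"
    and T: "\<And>z. z \<in> closure (region P) \<Longrightarrow> \<bar>taylor_remainder \<phi> G H x z\<bar> \<le> C * norm (z - x) ^ 3"
    and I: "\<And>z. z \<in> closure (region P) \<Longrightarrow> \<bar>interp m \<Phi> z - \<phi> z\<bar> \<le> e"
    and h: "norm (y - x) \<le> c * sqrt \<Delta>t"
    and d: "y \<notin> closure (region P) \<Longrightarrow> \<bar>dgam P b y\<bar> \<le> L * norm (y - x)"
    and proj: "y \<notin> closure (region P) \<Longrightarrow> y = pgam P b y + dgam P b y *\<^sub>R gam P b (pgam P b y)"
    and unit: "y \<notin> closure (region P) \<Longrightarrow> norm (gam P b (pgam P b y)) = 1"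
    and refl: "y \<notin> closure (region P) \<Longrightarrow> reflected P \<Delta>t y b \<in> closure (region P)"
    and H: "\<And>v. norm (H x *v v) \<le> B * norm v"
    and nonneg: "0 \<le> C" "0 \<le> L" "0 \<le> B" "0 \<le> cbar P"
  shows "\<bar>D\<bar> \<le> (L * c + cbar P) * sqrt \<Delta>t"
    and "\<bar>K\<bar> \<le> 1/2 * (L * c + cbar P) * B + c * B"
    and "\<bar>interp m \<Phi> (ytil P m \<Delta>t k i s a b) + D * gtil P m \<Delta>t k i s a b - \<phi> x
           - (G x \<bullet> (y - x) + 1/2 * ((y - x) \<bullet> (H x *v (y - x))))
           + D * (Ltil P m \<Delta>t k i s (G x) a b - sqrt \<Delta>t * K)\<bar>
         \<le> C * (c + L * c + cbar P) ^ 3 * (\<Delta>t * sqrt \<Delta>t) + e"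
proof -
  let ?\<Omega> = "region P" and ?r = "sqrt \<Delta>t"
  let ?v = "gam P b (pgam P b y)" and ?h = "y - x"
  have r: "0 < ?r" "?r * ?r = \<Delta>t" "?r ^ 3 = \<Delta>t * ?r"
    using \<open>0 < \<Delta>t\<close> by (auto simp: power3_eq_cube)
  have "0 \<le> c * ?r" using h norm_ge_zero order_trans by blast
  then have "0 \<le> c" using r(1) by (simp add: zero_le_mult_iff)
  have dist: "\<bar>taylor_remainder \<phi> G H x z\<bar> \<le> C * (c + L * c + cbar P) ^ 3 * (\<Delta>t * ?r)"
    if "z \<in> closure ?\<Omega>" "norm (z - x) \<le> (c + L * c + cbar P) * ?r" for z
  proof -
    have "\<bar>taylor_remainder \<phi> G H x z\<bar> \<le> C * norm (z - x) ^ 3" using that by (intro T)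
    also have "\<dots> \<le> C * ((c + L * c + cbar P) * ?r) ^ 3"
      using that nonneg by (intro mult_left_mono power_mono) auto
    finally show ?thesis by (simp add: power_mult_distrib r mult.assoc)
  qed
  have le: "c * ?r \<le> (c + L * c + cbar P) * ?r" "0 \<le> L * c + cbar P"
    using nonneg \<open>0 \<le> c\<close> r by (auto intro!: mult_right_mono)
  have dbound: "\<bar>D\<bar> \<le> (L * c + cbar P) * ?r"
  proof (cases "y \<in> closure ?\<Omega>")
    case True
    then show ?thesis using le r by (simp add: D_def dtil_def y_def Let_def)
  next
    case False
    have "\<bar>D\<bar> = \<bar>dgam P b y + cbar P * ?r\<bar>" using False by (simp add: D_def dtil_def y_def Let_def)
    also have "\<dots> \<le> L * norm ?h + cbar P * ?r"
      using d[OF False] nonneg r by (intro order_trans[OF abs_triangle_ineq]) (auto intro!: add_mono)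
    also have "\<dots> \<le> L * (c * ?r) + cbar P * ?r"
      using h nonneg by (intro add_mono mult_left_mono) auto
    finally show ?thesis by (simp add: algebra_simps)
  qed
  then show "\<bar>D\<bar> \<le> (L * c + cbar P) * ?r" .
  have K_out: "?r * K = 1/2 * D * (?v \<bullet> (H x *v ?v)) - 1/2 * (?h \<bullet> (H x *v ?v) + ?v \<bullet> (H x *v ?h))"
    if "y \<notin> closure ?\<Omega>"
    using that r unfolding K_def boundary_correction_def x_def y_def D_def Let_def by simp
  show "\<bar>K\<bar> \<le> 1/2 * (L * c + cbar P) * B + c * B"
  proof (cases "y \<in> closure ?\<Omega>")
    case True
    then show ?thesis using le nonneg \<open>0 \<le> c\<close> by (simp add: K_def boundary_correction_def y_def Let_def)
  next
    case False
    have form: "\<bar>p \<bullet> (H x *v q)\<bar> \<le> B * (norm p * norm q)" for p q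
    proof -
      have "\<bar>p \<bullet> (H x *v q)\<bar> \<le> norm p * norm (H x *v q)" by (rule Cauchy_Schwarz_ineq2)
      also have "\<dots> \<le> norm p * (B * norm q)" by (intro mult_left_mono H) auto
      finally show ?thesis by (simp add: ac_simps)
    qed
    have combine: "\<bar>1/2 * p - 1/2 * (q + u)\<bar> \<le> 1/2 * e\<^sub>1 + e\<^sub>2"
      if "\<bar>p\<bar> \<le> e\<^sub>1" "\<bar>q\<bar> \<le> e\<^sub>2" "\<bar>u\<bar> \<le> e\<^sub>2" for p q u e\<^sub>1 e\<^sub>2 :: real
    proof (rule abs_leI)
      note bounds = that[THEN abs_le_D1] that[THEN abs_le_D2]
      show "1/2 * p - 1/2 * (q + u) \<le> 1/2 * e\<^sub>1 + e\<^sub>2" "- (1/2 * p - 1/2 * (q + u)) \<le> 1/2 * e\<^sub>1 + e\<^sub>2"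
        using bounds by argo+
    qed
    have vv: "\<bar>?v \<bullet> (H x *v ?v)\<bar> \<le> B" using form[of ?v ?v] unit[OF False] by simp
    have "\<bar>D * (?v \<bullet> (H x *v ?v))\<bar> \<le> (L * c + cbar P) * ?r * B"
      unfolding abs_mult using dbound vv le r by (intro mult_mono) auto
    moreover have "B * norm ?h \<le> c * B * ?r" using mult_left_mono[OF h nonneg(3)] by (simp add: ac_simps)
    then have "\<bar>?h \<bullet> (H x *v ?v)\<bar> \<le> c * B * ?r" "\<bar>?v \<bullet> (H x *v ?h)\<bar> \<le> c * B * ?r"
      using form[of ?h ?v] form[of ?v ?h] unit[OF False] by auto
    ultimately have "\<bar>?r * K\<bar> \<le> 1/2 * ((L * c + cbar P) * ?r * B) + c * B * ?r"
      unfolding K_out[OF False] mult.assoc[of "1/2" D] by (rule combine)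
    also have "\<dots> = ?r * (1/2 * (L * c + cbar P) * B + c * B)" by (simp add: algebra_simps)
    finally have "?r * \<bar>K\<bar> \<le> ?r * (1/2 * (L * c + cbar P) * B + c * B)"
      using r by (simp add: abs_mult)
    then show ?thesis using r by simp
  qed
  show "\<bar>interp m \<Phi> (ytil P m \<Delta>t k i s a b) + D * gtil P m \<Delta>t k i s a b - \<phi> x
           - (G x \<bullet> ?h + 1/2 * (?h \<bullet> (H x *v ?h)))
           + D * (Ltil P m \<Delta>t k i s (G x) a b - ?r * K)\<bar>
         \<le> C * (c + L * c + cbar P) ^ 3 * (\<Delta>t * ?r) + e"
  proof (cases "y \<in> closure ?\<Omega>")
    case True
    then have "ytil P m \<Delta>t k i s a b = y" "D = 0"
      by (simp_all add: D_def dtil_def ytil_def y_def Let_def)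
    moreover have "\<bar>taylor_remainder \<phi> G H x y\<bar> \<le> C * (c + L * c + cbar P) ^ 3 * (\<Delta>t * ?r)"
      using dist[OF True] h le by linarith
    ultimately show ?thesis using I[OF True] by (simp add: taylor_remainder_def)
  next
    case False
    have D: "D = dgam P b y + cbar P * ?r" using False by (simp add: D_def dtil_def y_def Let_def)
    \<comment> \<open>Reflection goes from the oblique projection a further \<open>cbar P * sqrt \<Delta>t\<close> into the domain.\<close>
    have shift: "q - f *\<^sub>R w = y' - (l + f) *\<^sub>R w" if "y' = q + l *\<^sub>R w" for q w y' :: "real^'n" and l f
      unfolding that by (simp add: algebra_simps)
    have z: "reflected P \<Delta>t y b = y - D *\<^sub>R ?v"
      unfolding reflected_def D by (rule shift[OF proj[OF False]])
    have yt: "ytil P m \<Delta>t k i s a b = y - D *\<^sub>R ?v"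
      using False z by (simp add: ytil_def y_def Let_def)
    have zin: "y - D *\<^sub>R ?v \<in> closure ?\<Omega>" using refl[OF False] z by simp
    have "norm (y - D *\<^sub>R ?v - x) = norm (?h - D *\<^sub>R ?v)" by (simp add: algebra_simps)
    also have "\<dots> \<le> norm ?h + \<bar>D\<bar>"
      using norm_triangle_ineq4[of ?h "D *\<^sub>R ?v"] unit[OF False] by simp
    also have "\<dots> \<le> (c + L * c + cbar P) * ?r"
      using h dbound by (simp add: distrib_right)
    finally have R: "\<bar>taylor_remainder \<phi> G H x (y - D *\<^sub>R ?v)\<bar> \<le> C * (c + L * c + cbar P) ^ 3 * (\<Delta>t * ?r)"
      by (rule dist[OF zin])
    have L: "Ltil P m \<Delta>t k i s (G x) a b = G x \<bullet> ?v - gtil P m \<Delta>t k i s a b"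
      using False by (simp add: Ltil_def Lop_def gtil_def y_def Let_def inner_commute)
    have "interp m \<Phi> (ytil P m \<Delta>t k i s a b) + D * gtil P m \<Delta>t k i s a b - \<phi> x
           - (G x \<bullet> ?h + 1/2 * (?h \<bullet> (H x *v ?h)))
           + D * (Ltil P m \<Delta>t k i s (G x) a b - ?r * K)
        = (interp m \<Phi> (y - D *\<^sub>R ?v) - \<phi> (y - D *\<^sub>R ?v)) + taylor_remainder \<phi> G H x (y - D *\<^sub>R ?v)"
      unfolding taylor_remainder_oblique_shift K_out[OF False] yt L by (simp add: right_diff_distrib)
    then show ?thesis using I[OF zin] R by linarith
  qed
qed

theorem proposition4p2:
  fixes P :: "('n::finite, 'na::finite, 'nb::finite, 's::finite) problem"
    and sizes :: "real set" and mesh :: "real \<Rightarrow> 'n mesh"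
    and \<Delta>tbar :: real
    and \<phi> :: "real^'n \<Rightarrow> real"
    and D\<phi> :: "real^'n \<Rightarrow> real^'n"
    and D2\<phi> :: "real^'n \<Rightarrow> real^'n^'n"
  assumes "standing_assumptions P"
    and "oblique_projection_unique P"
    and "cbar P > 0"
    and "mesh_family (region P) sizes mesh"
    and "\<Delta>tbar > 0" and "well_defined_up_to P sizes mesh \<Delta>tbar"
    and "Ck_closure 3 \<phi> (region P)"
    and "gradient_on_closure (region P) \<phi> D\<phi>"
    and "hessian_on_closure (region P) \<phi> D2\<phi>"
  shows "\<exists>K :: real \<Rightarrow> real \<Rightarrow> nat \<Rightarrow> nat \<Rightarrow> bool \<times> 's \<Rightarrow> real^'na \<Rightarrow> real^'nb \<Rightarrow> real.
    (\<exists>M. \<forall>\<Delta>t\<in>{0<..\<Delta>tbar}. \<forall>\<Delta>x\<in>sizes. \<forall>k<num_steps P \<Delta>t. \<forall>i\<in>indices (mesh \<Delta>x).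
       \<forall>s. \<forall>a\<in>ctrlA P. \<forall>b\<in>ctrlB P. \<bar>K \<Delta>t \<Delta>x k i s a b\<bar> \<le> M) \<and>
    (\<exists>C. \<forall>\<Delta>t\<in>{0<..\<Delta>tbar}. \<forall>\<Delta>x\<in>sizes. \<forall>k<num_steps P \<Delta>t. \<forall>i\<in>indices (mesh \<Delta>x).
       \<forall>a\<in>ctrlA P. \<forall>b\<in>ctrlB P.
         (let m = mesh \<Delta>x; x = vert m i in
          \<bar>(scheme_ab P m \<Delta>t k i (restrict \<phi> (vertices m)) a b - \<phi> x) -
            (- \<Delta>t * Hop P (tm \<Delta>t k) x (D\<phi> x) (D2\<phi> x) a
             - 1 / (2 * real CARD('s)) *
                 (\<Sum>s\<in>UNIV. dtil P m \<Delta>t k i s a b *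
                    (Ltil P m \<Delta>t k i s (D\<phi> x) a b - sqrt \<Delta>t * K \<Delta>t \<Delta>x k i s a b)))\<bar>
          \<le> C * (\<Delta>t * sqrt \<Delta>t + \<Delta>x\<^sup>2))) \<and>
    (\<exists>C. \<forall>\<Delta>t\<in>{0<..\<Delta>tbar}. \<forall>\<Delta>x\<in>sizes. \<forall>k<num_steps P \<Delta>t. \<forall>i\<in>indices (mesh \<Delta>x).
         (let m = mesh \<Delta>x; x = vert m i in
          \<bar>(scheme P m \<Delta>t k i (restrict \<phi> (vertices m)) - \<phi> x) -
            (- (SUP (a, b)\<in>ctrlA P \<times> ctrlB P.
                 \<Delta>t * Hop P (tm \<Delta>t k) x (D\<phi> x) (D2\<phi> x) a
                 + 1 / (2 * real CARD('s)) *
                     (\<Sum>s\<in>UNIV. dtil P m \<Delta>t k i s a b *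
                        (Ltil P m \<Delta>t k i s (D\<phi> x) a b - sqrt \<Delta>t * K \<Delta>t \<Delta>x k i s a b))))\<bar>
          \<le> C * (\<Delta>t * sqrt \<Delta>t + \<Delta>x\<^sup>2)))"
proof -
  let ?\<Omega> = "region P" and ?N = "real CARD('s)"
  let ?F = "frontier ?\<Omega>"
  have \<Omega>: "open ?\<Omega>" "bounded ?\<Omega>" "Ck_boundary (Suc 2) ?\<Omega>" and AB: "ctrlA P \<noteq> {}" "ctrlB P \<noteq> {}"
    and cB: "compact (ctrlB P)"
    and unit: "\<And>x b. x \<in> ?F \<Longrightarrow> b \<in> ctrlB P \<Longrightarrow> norm (gam P b x) = 1"
    using assms(1) by (auto simp: standing_assumptions_def)
  have cpt: "compact (closure ?\<Omega>)" using \<Omega> by simp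
  have cG: "continuous_on (closure ?\<Omega>) D\<phi>" and cH: "continuous_on (closure ?\<Omega>) D2\<phi>"
    using assms(8,9) by (auto simp: gradient_on_closure_def hessian_on_closure_def)
  obtain CT where CT: "0 \<le> CT" "\<And>x y. x \<in> closure ?\<Omega> \<Longrightarrow> y \<in> closure ?\<Omega> \<Longrightarrow>
      \<bar>taylor_remainder \<phi> D\<phi> D2\<phi> x y\<bar> \<le> CT * norm (y - x) ^ 3"
    using taylor_on_closure[OF \<Omega> assms(7,8,9)] by blast
  obtain C1 where C1: "0 \<le> C1" "\<And>x y. x \<in> closure ?\<Omega> \<Longrightarrow> y \<in> closure ?\<Omega> \<Longrightarrow>
      \<bar>\<phi> y - \<phi> x - D\<phi> x \<bullet> (y - x)\<bar> \<le> C1 * norm (y - x) ^ 2"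
    using taylor_first_order_on_closure[OF \<Omega>(2) cH CT(2,1)] by blast
  obtain CI where CI: "0 \<le> CI" "\<And>\<Delta>x x. \<Delta>x \<in> sizes \<Longrightarrow> x \<in> closure ?\<Omega> \<Longrightarrow>
      \<bar>interp (mesh \<Delta>x) (restrict \<phi> (vertices (mesh \<Delta>x))) x - \<phi> x\<bar> \<le> CI * \<Delta>x\<^sup>2"
    using interp_error[OF \<Omega>(2) assms(4) cG C1(2,1)] by blast
  obtain B where B: "0 \<le> B"
    "\<And>t x a. t \<in> {0..horizon P} \<Longrightarrow> x \<in> closure ?\<Omega> \<Longrightarrow> a \<in> ctrlA P \<Longrightarrow> norm (mu P t x a) \<le> B"
    "\<And>t x a j. t \<in> {0..horizon P} \<Longrightarrow> x \<in> closure ?\<Omega> \<Longrightarrow> a \<in> ctrlA P \<Longrightarrow> norm (column j (sig P t x a)) \<le> B"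
    "\<And>t x a. t \<in> {0..horizon P} \<Longrightarrow> x \<in> closure ?\<Omega> \<Longrightarrow> a \<in> ctrlA P \<Longrightarrow> \<bar>runcost P t x a\<bar> \<le> B"
    "\<And>t x b. t \<in> {0..horizon P} \<Longrightarrow> x \<in> ?F \<Longrightarrow> b \<in> ctrlB P \<Longrightarrow> \<bar>bdcost P t x b\<bar> \<le> B"
    using bounded_coefficients[OF assms(1)] by blast
  obtain BH where BH: "0 \<le> BH" "\<And>x v. x \<in> closure ?\<Omega> \<Longrightarrow> norm (D2\<phi> x *v v) \<le> BH * norm v"
    using bounded_matrix_field[OF cpt cH] by metis
  have obl: "oblique_projection P (tubeR P) (pgam P) (dgam P)" and R0: "0 < tubeR P"
    using assms(2) by (auto simp: oblique_projection_unique_def)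
  obtain L where L: "0 \<le> L" "\<And>x y b. x \<in> closure ?\<Omega> \<Longrightarrow> y \<notin> closure ?\<Omega> \<Longrightarrow>
       infdist y ?F < tubeR P \<Longrightarrow> b \<in> ctrlB P \<Longrightarrow> \<bar>dgam P b y\<bar> \<le> L * norm (y - x)"
    using oblique_distance_bound[OF \<Omega>(2) cB R0 obl unit] by blast
  \<comment> \<open>In units of \<open>sqrt \<Delta>t\<close>, the displacement is bounded by \<open>c\<close> and \<open>dtil\<close> by \<open>L * c + cbar P\<close>; the second
    summand of \<open>C\<close> accounts for the term of order \<open>\<Delta>t\<^sup>2\<close> in the drift.\<close>
  define c where "c = (sqrt \<Delta>tbar + sqrt ?N) * B"
  define K where "K = (\<lambda>\<Delta>t \<Delta>x. boundary_correction P D2\<phi> (mesh \<Delta>x) \<Delta>t)"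
  define M where "M = 1/2 * (L * c + cbar P) * BH + c * BH"
  define Cs where "Cs = CT * (c + L * c + cbar P) ^ 3 + CI"
  define C where "C = Cs + 1/2 * BH * B\<^sup>2 * sqrt \<Delta>tbar"
  define X where "X = (\<lambda>\<Delta>t \<Delta>x k i a b. let m = mesh \<Delta>x; x = vert m i in
      \<Delta>t * Hop P (tm \<Delta>t k) x (D\<phi> x) (D2\<phi> x) a + 1 / (2 * ?N) *
         (\<Sum>s\<in>UNIV. dtil P m \<Delta>t k i s a b *
            (Ltil P m \<Delta>t k i s (D\<phi> x) a b - sqrt \<Delta>t * K \<Delta>t \<Delta>x k i s a b)))"
  have vert_in: "vert (mesh \<Delta>x) i \<in> closure ?\<Omega>" if "\<Delta>x \<in> sizes" "i \<in> indices (mesh \<Delta>x)" for \<Delta>x i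
  proof -
    have "exactly_triangulated ?\<Omega> (mesh \<Delta>x)" "bij_betw (vert (mesh \<Delta>x)) (indices (mesh \<Delta>x)) (vertices (mesh \<Delta>x))"
      using assms(4) that(1) unfolding mesh_family_def triangulated_def by blast+
    then show ?thesis
      using vertices_subset_closure[of ?\<Omega> "mesh \<Delta>x"] bij_betw_apply that(2) by fast
  qed
  have main: "\<bar>K \<Delta>t \<Delta>x k i s a b\<bar> \<le> M
      \<and> \<bar>dtil P (mesh \<Delta>x) \<Delta>t k i s a b\<bar> \<le> (L * c + cbar P) * sqrt \<Delta>t
      \<and> \<bar>scheme_ab P (mesh \<Delta>x) \<Delta>t k i (restrict \<phi> (vertices (mesh \<Delta>x))) a b - \<phi> (vert (mesh \<Delta>x) i)
           + X \<Delta>t \<Delta>x k i a b\<bar> \<le> C * (\<Delta>t * sqrt \<Delta>t + \<Delta>x\<^sup>2)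
      \<and> \<bar>Ltil P (mesh \<Delta>x) \<Delta>t k i s (D\<phi> (vert (mesh \<Delta>x) i)) a b\<bar> \<le> norm (D\<phi> (vert (mesh \<Delta>x) i)) + B"
    if dt: "\<Delta>t \<in> {0<..\<Delta>tbar}" and dx: "\<Delta>x \<in> sizes" and k: "k < num_steps P \<Delta>t"
      and i: "i \<in> indices (mesh \<Delta>x)" and a: "a \<in> ctrlA P" and b: "b \<in> ctrlB P"
    for \<Delta>t \<Delta>x k i s a b
  proof -
    let ?m = "mesh \<Delta>x"
    let ?x = "vert ?m i" and ?t = "tm \<Delta>t k" and ?\<Phi> = "restrict \<phi> (vertices ?m)"
    let ?y = "\<lambda>s. ypt P ?m \<Delta>t k i s a" and ?D = "\<lambda>s. dtil P ?m \<Delta>t k i s a b"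
    have dt': "0 < \<Delta>t" "\<Delta>t \<le> \<Delta>tbar" using dt by auto
    have x: "?x \<in> closure ?\<Omega>" using vert_in dx i .
    have t: "?t \<in> {0..horizon P}" using time_step_in_horizon[OF dt'(1) k] .
    have out: "infdist (?y s) ?F < tubeR P" "reflected P \<Delta>t (?y s) b \<in> closure ?\<Omega>"
      if "?y s \<notin> closure ?\<Omega>" for s
      using assms(6) dt' dx k i a b that unfolding well_defined_up_to_def by blast+
    have pr: "pgam P b (?y s) \<in> ?F" "?y s = pgam P b (?y s) + dgam P b (?y s) *\<^sub>R gam P b (pgam P b (?y s))"
      if "?y s \<notin> closure ?\<Omega>" for s
      using obl out(1)[OF that] b by (auto simp: oblique_projection_def Let_def)
    have h: "norm (?y s - ?x) \<le> c * sqrt \<Delta>t" for s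
      unfolding c_def by (rule ypt_displacement_bound[OF dt' B(2)[OF t x a] B(3)[OF t x a]])
    have Lt: "\<bar>Ltil P ?m \<Delta>t k i s (D\<phi> ?x) a b\<bar> \<le> norm (D\<phi> ?x) + B" for s
    proof (cases "?y s \<in> closure ?\<Omega>")
      case True
      then show ?thesis using B(1) by (simp add: Ltil_def Let_def)
    next
      case False
      let ?p = "pgam P b (?y s)"
      have "Ltil P ?m \<Delta>t k i s (D\<phi> ?x) a b = gam P b ?p \<bullet> D\<phi> ?x - bdcost P ?t ?p b"
        using False by (simp add: Ltil_def Lop_def Let_def)
      moreover have "\<bar>gam P b ?p \<bullet> D\<phi> ?x\<bar> \<le> norm (D\<phi> ?x)"
        using Cauchy_Schwarz_ineq2[of "gam P b ?p" "D\<phi> ?x"] unit[OF pr(1)[OF False] b] by simp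
      ultimately show ?thesis using B(5)[OF t pr(1)[OF False] b] by linarith
    qed
    let ?E = "\<lambda>s. interp ?m ?\<Phi> (ytil P ?m \<Delta>t k i s a b) + ?D s * gtil P ?m \<Delta>t k i s a b - \<phi> ?x
           - (D\<phi> ?x \<bullet> (?y s - ?x) + 1/2 * ((?y s - ?x) \<bullet> (D2\<phi> ?x *v (?y s - ?x))))
           + ?D s * (Ltil P ?m \<Delta>t k i s (D\<phi> ?x) a b - sqrt \<Delta>t * K \<Delta>t \<Delta>x k i s a b)"
    have c0: "0 \<le> cbar P" using assms(3) by simp
    have gam1: "norm (gam P b (pgam P b (?y s))) = 1" if "?y s \<notin> closure ?\<Omega>" for s
      using unit[OF pr(1)[OF that] b] .
    note expansion = scheme_summand_expansion[where m = ?m and k = k and i = i and a = a and b = b and \<phi> = \<phi>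
        and \<Phi> = ?\<Phi> and G = D\<phi> and H = D2\<phi> and P = P and \<Delta>t = \<Delta>t,
        OF dt'(1) x CT(2)[OF x] CI(2)[OF dx] h L(2)[OF x _ out(1) b] pr(2) gam1 out(2) BH(2)[OF x]
          CT(1) L(1) BH(1) c0]
    have D: "\<bar>?D s\<bar> \<le> (L * c + cbar P) * sqrt \<Delta>t" for s
      by (rule expansion(1)) auto
    have KM: "\<bar>K \<Delta>t \<Delta>x k i s a b\<bar> \<le> M" for s
      unfolding K_def M_def by (rule expansion(2)) auto
    have "\<bar>?E s\<bar> \<le> CT * (c + L * c + cbar P) ^ 3 * (\<Delta>t * sqrt \<Delta>t) + CI * \<Delta>x\<^sup>2" for s
      unfolding K_def by (rule expansion(3)) auto
    moreover have cn: "0 \<le> c" using B(1) assms(5) by (simp add: c_def)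
    moreover have "CT * (c + L * c + cbar P) ^ 3 * (\<Delta>t * sqrt \<Delta>t) + CI * \<Delta>x\<^sup>2 \<le> Cs * (\<Delta>t * sqrt \<Delta>t + \<Delta>x\<^sup>2)"
    proof -
      have "0 \<le> CI * (\<Delta>t * sqrt \<Delta>t)" using CI(1) dt' by simp
      moreover have "0 \<le> CT * (c + L * c + cbar P) ^ 3 * \<Delta>x\<^sup>2"
        using CT(1) cn L(1) c0 by simp
      ultimately show ?thesis by (simp add: Cs_def distrib_right distrib_left)
    qed
    ultimately have E: "\<bar>?E s\<bar> \<le> Cs * (\<Delta>t * sqrt \<Delta>t + \<Delta>x\<^sup>2)" for s by (meson order_trans)
    have avg: "\<bar>1 / (2 * ?N) * (\<Sum>s\<in>UNIV. ?E s)\<bar> \<le> Cs * (\<Delta>t * sqrt \<Delta>t + \<Delta>x\<^sup>2)"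
    proof -
      have "\<bar>\<Sum>s\<in>UNIV. ?E s\<bar> \<le> (\<Sum>s\<in>(UNIV :: (bool \<times> 's) set). Cs * (\<Delta>t * sqrt \<Delta>t + \<Delta>x\<^sup>2))"
        by (rule order_trans[OF sum_abs]) (intro sum_mono E)
      also have "\<dots> = 2 * ?N * (Cs * (\<Delta>t * sqrt \<Delta>t + \<Delta>x\<^sup>2))" by simp
      finally show ?thesis by (simp add: abs_mult field_simps)
    qed
    let ?\<mu> = "mu P ?t ?x a"
    have sums: "1 / (2 * ?N) * (\<Sum>s\<in>UNIV. D\<phi> ?x \<bullet> (?y s - ?x) + 1/2 * ((?y s - ?x) \<bullet> (D2\<phi> ?x *v (?y s - ?x))))
        = - \<Delta>t * Hop P ?t ?x (D\<phi> ?x) (D2\<phi> ?x) a - \<Delta>t * runcost P ?t ?x a + 1/2 * \<Delta>t\<^sup>2 * (?\<mu> \<bullet> (D2\<phi> ?x *v ?\<mu>))"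
    proof -
      have y: "?y s - ?x = \<Delta>t *\<^sub>R ?\<mu> + ((if fst s then 1 else - 1) * sqrt (real CARD('s) * \<Delta>t))
          *\<^sub>R column (snd s) (sig P ?t ?x a)" for s
        by (simp add: ypt_def)
      show ?thesis
        unfolding y symmetric_walk_second_order_sum[OF less_imp_le[OF dt'(1)]] Hop_def
        by (simp add: algebra_simps)
    qed
    have "\<bar>?\<mu> \<bullet> (D2\<phi> ?x *v ?\<mu>)\<bar> \<le> BH * B\<^sup>2"
    proof -
      have "\<bar>?\<mu> \<bullet> (D2\<phi> ?x *v ?\<mu>)\<bar> \<le> norm ?\<mu> * norm (D2\<phi> ?x *v ?\<mu>)" by (rule Cauchy_Schwarz_ineq2)
      also have "\<dots> \<le> B * (BH * B)"
        using B(1) BH(1) B(2)[OF t x a] BH(2)[OF x, of ?\<mu>]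
        by (intro mult_mono) (auto intro: order_trans mult_left_mono)
      finally show ?thesis by (simp add: power2_eq_square ac_simps)
    qed
    then have "\<bar>1/2 * \<Delta>t\<^sup>2 * (?\<mu> \<bullet> (D2\<phi> ?x *v ?\<mu>))\<bar> \<le> 1/2 * \<Delta>t\<^sup>2 * (BH * B\<^sup>2)"
      by (simp add: abs_mult mult_left_mono)
    also have "\<dots> = 1/2 * (\<Delta>t * sqrt \<Delta>t * sqrt \<Delta>t) * (BH * B\<^sup>2)"
      using dt' by (simp add: power2_eq_square)
    also have "\<dots> \<le> 1/2 * (\<Delta>t * sqrt \<Delta>t * sqrt \<Delta>tbar) * (BH * B\<^sup>2)"
      using dt' BH(1) by (intro mult_right_mono mult_left_mono) auto
    also have "\<dots> = 1/2 * BH * B\<^sup>2 * sqrt \<Delta>tbar * (\<Delta>t * sqrt \<Delta>t)" by simp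
    also have "\<dots> \<le> 1/2 * BH * B\<^sup>2 * sqrt \<Delta>tbar * (\<Delta>t * sqrt \<Delta>t + \<Delta>x\<^sup>2)"
      using BH(1) assms(5) by (intro mult_left_mono) auto
    finally have drift: "\<bar>1/2 * \<Delta>t\<^sup>2 * (?\<mu> \<bullet> (D2\<phi> ?x *v ?\<mu>))\<bar> \<le> \<dots>" .
    \<comment> \<open>The errors of the summands average to the error of the scheme, except for the term of order
      \<open>\<Delta>t\<^sup>2\<close> in the drift.\<close>
    have "1 / (2 * ?N) * (\<Sum>s\<in>UNIV. ?E s)
        = 1 / (2 * ?N) * (\<Sum>s\<in>UNIV. interp ?m ?\<Phi> (ytil P ?m \<Delta>t k i s a b) + ?D s * gtil P ?m \<Delta>t k i s a b)
          - \<phi> ?x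
          - 1 / (2 * ?N) * (\<Sum>s\<in>UNIV. D\<phi> ?x \<bullet> (?y s - ?x) + 1/2 * ((?y s - ?x) \<bullet> (D2\<phi> ?x *v (?y s - ?x))))
          + 1 / (2 * ?N) * (\<Sum>s\<in>UNIV. ?D s * (Ltil P ?m \<Delta>t k i s (D\<phi> ?x) a b - sqrt \<Delta>t * K \<Delta>t \<Delta>x k i s a b))"
    proof -
      have "1 / (2 * ?N) * (\<Sum>s\<in>UNIV. f s - p - g s + q s)
          = 1 / (2 * ?N) * sum f UNIV - p - 1 / (2 * ?N) * sum g UNIV + 1 / (2 * ?N) * sum q UNIV"
        for f g q :: "bool \<times> 's \<Rightarrow> real" and p
        by (simp add: sum.distrib sum_subtractf field_simps)
      then show ?thesis .
    qed
    then have "scheme_ab P ?m \<Delta>t k i ?\<Phi> a b - \<phi> ?x + X \<Delta>t \<Delta>x k i a b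
        = 1 / (2 * ?N) * (\<Sum>s\<in>UNIV. ?E s) + 1/2 * \<Delta>t\<^sup>2 * (?\<mu> \<bullet> (D2\<phi> ?x *v ?\<mu>))"
      unfolding sums scheme_ab_def X_def Let_def by linarith
    then have "\<bar>scheme_ab P ?m \<Delta>t k i ?\<Phi> a b - \<phi> ?x + X \<Delta>t \<Delta>x k i a b\<bar> \<le> C * (\<Delta>t * sqrt \<Delta>t + \<Delta>x\<^sup>2)"
      using avg drift unfolding C_def distrib_right by linarith
    then show ?thesis using KM D Lt by blast
  qed
  \<comment> \<open>The supremum of an unbounded set of reals is unspecified, so boundedness over the controls has to
    be established for each time step, mesh and vertex.\<close>
  have Xbound: "\<exists>b. \<forall>p\<in>ctrlA P \<times> ctrlB P. \<bar>X \<Delta>t \<Delta>x k i (fst p) (snd p)\<bar> \<le> b"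
    if dt: "\<Delta>t \<in> {0<..\<Delta>tbar}" and dx: "\<Delta>x \<in> sizes" and k: "k < num_steps P \<Delta>t"
      and i: "i \<in> indices (mesh \<Delta>x)" for \<Delta>t \<Delta>x k i
  proof -
    let ?m = "mesh \<Delta>x"
    let ?x = "vert ?m i" and ?t = "tm \<Delta>t k"
    have dt': "0 < \<Delta>t" using dt by auto
    have x: "?x \<in> closure ?\<Omega>" using vert_in dx i .
    have t: "?t \<in> {0..horizon P}" using time_step_in_horizon[OF dt' k] .
    let ?g = "norm (D\<phi> ?x)"
    define bH where "bH = 1/2 * (?N * (B * (BH * B))) + B * ?g + B"
    define bL where "bL = (L * c + cbar P) * sqrt \<Delta>t * (?g + B + sqrt \<Delta>t * M)"
    have "\<bar>X \<Delta>t \<Delta>x k i a b\<bar> \<le> \<Delta>t * bH + bL" if a: "a \<in> ctrlA P" and b: "b \<in> ctrlB P" for a b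
    proof -
      let ?S = "sig P ?t ?x a"
      have "\<bar>trace (?S ** transpose ?S ** D2\<phi> ?x)\<bar> \<le> (\<Sum>j\<in>(UNIV::'s set). B * (BH * B))"
        unfolding trace_conjugate_eq_sum_columns
      proof (rule order_trans[OF sum_abs], rule sum_mono)
        fix j
        have "\<bar>column j ?S \<bullet> (D2\<phi> ?x *v column j ?S)\<bar> \<le> norm (column j ?S) * norm (D2\<phi> ?x *v column j ?S)"
          by (rule Cauchy_Schwarz_ineq2)
        also have "\<dots> \<le> B * (BH * B)"
          using B(1) BH(1) B(3)[OF t x a] BH(2)[OF x, of "column j ?S"]
          by (intro mult_mono) (auto intro: order_trans mult_left_mono)
        finally show "\<bar>column j ?S \<bullet> (D2\<phi> ?x *v column j ?S)\<bar> \<le> B * (BH * B)" .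
      qed
      moreover have "\<bar>mu P ?t ?x a \<bullet> D\<phi> ?x\<bar> \<le> B * ?g"
        using Cauchy_Schwarz_ineq2[of "mu P ?t ?x a" "D\<phi> ?x"] mult_right_mono[OF B(2)[OF t x a], of ?g]
        by simp
      ultimately have "\<bar>Hop P ?t ?x (D\<phi> ?x) (D2\<phi> ?x) a\<bar> \<le> bH"
        using B(4)[OF t x a] unfolding Hop_def bH_def by simp
      then have 1: "\<bar>\<Delta>t * Hop P ?t ?x (D\<phi> ?x) (D2\<phi> ?x) a\<bar> \<le> \<Delta>t * bH"
        using dt' by (simp add: abs_mult)
      let ?q = "\<lambda>s. dtil P ?m \<Delta>t k i s a b * (Ltil P ?m \<Delta>t k i s (D\<phi> ?x) a b - sqrt \<Delta>t * K \<Delta>t \<Delta>x k i s a b)"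
      have q: "\<bar>?q s\<bar> \<le> bL" for s
      proof -
        note m = main[OF dt dx k i a b, of s]
        have "\<bar>sqrt \<Delta>t * K \<Delta>t \<Delta>x k i s a b\<bar> \<le> sqrt \<Delta>t * M"
          using m dt' by (simp add: abs_mult)
        then have "\<bar>Ltil P ?m \<Delta>t k i s (D\<phi> ?x) a b - sqrt \<Delta>t * K \<Delta>t \<Delta>x k i s a b\<bar> \<le> ?g + B + sqrt \<Delta>t * M"
          using m by linarith
        then show ?thesis
          unfolding bL_def abs_mult using m by (intro mult_mono) auto
      qed
      have "\<bar>\<Sum>s\<in>UNIV. ?q s\<bar> \<le> (\<Sum>s\<in>(UNIV :: (bool \<times> 's) set). bL)"
        by (rule order_trans[OF sum_abs]) (intro sum_mono q)
      also have "\<dots> = 2 * ?N * bL" by simp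
      finally have "\<bar>1 / (2 * ?N) * (\<Sum>s\<in>UNIV. ?q s)\<bar> \<le> bL" by (simp add: abs_mult field_simps)
      with 1 show ?thesis unfolding X_def Let_def by linarith
    qed
    then show ?thesis by auto
  qed
  show ?thesis
  proof (intro exI[of _ K] conjI)
    show "\<exists>M. \<forall>\<Delta>t\<in>{0<..\<Delta>tbar}. \<forall>\<Delta>x\<in>sizes. \<forall>k<num_steps P \<Delta>t. \<forall>i\<in>indices (mesh \<Delta>x).
       \<forall>s. \<forall>a\<in>ctrlA P. \<forall>b\<in>ctrlB P. \<bar>K \<Delta>t \<Delta>x k i s a b\<bar> \<le> M"
      using main by blast
    show "\<exists>C. \<forall>\<Delta>t\<in>{0<..\<Delta>tbar}. \<forall>\<Delta>x\<in>sizes. \<forall>k<num_steps P \<Delta>t. \<forall>i\<in>indices (mesh \<Delta>x).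
       \<forall>a\<in>ctrlA P. \<forall>b\<in>ctrlB P.
         (let m = mesh \<Delta>x; x = vert m i in
          \<bar>(scheme_ab P m \<Delta>t k i (restrict \<phi> (vertices m)) a b - \<phi> x) -
            (- \<Delta>t * Hop P (tm \<Delta>t k) x (D\<phi> x) (D2\<phi> x) a
             - 1 / (2 * real CARD('s)) *
                 (\<Sum>s\<in>UNIV. dtil P m \<Delta>t k i s a b *
                    (Ltil P m \<Delta>t k i s (D\<phi> x) a b - sqrt \<Delta>t * K \<Delta>t \<Delta>x k i s a b)))\<bar>
          \<le> C * (\<Delta>t * sqrt \<Delta>t + \<Delta>x\<^sup>2))"
    proof (intro exI[of _ C] ballI allI impI)
      fix \<Delta>t \<Delta>x k i a b
      assume *: "\<Delta>t \<in> {0<..\<Delta>tbar}" "\<Delta>x \<in> sizes" "k < num_steps P \<Delta>t" "i \<in> indices (mesh \<Delta>x)"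
        "a \<in> ctrlA P" "b \<in> ctrlB P"
      have eq: "p - (- \<Delta>t * q - r) = p + (\<Delta>t * q + r)" for p q r :: real by simp
      show "let m = mesh \<Delta>x; x = vert m i in
          \<bar>(scheme_ab P m \<Delta>t k i (restrict \<phi> (vertices m)) a b - \<phi> x) -
            (- \<Delta>t * Hop P (tm \<Delta>t k) x (D\<phi> x) (D2\<phi> x) a
             - 1 / (2 * real CARD('s)) *
                 (\<Sum>s\<in>UNIV. dtil P m \<Delta>t k i s a b *
                    (Ltil P m \<Delta>t k i s (D\<phi> x) a b - sqrt \<Delta>t * K \<Delta>t \<Delta>x k i s a b)))\<bar>
          \<le> C * (\<Delta>t * sqrt \<Delta>t + \<Delta>x\<^sup>2)"
        using main[OF *] unfolding X_def Let_def eq by blast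
    qed
    show "\<exists>C. \<forall>\<Delta>t\<in>{0<..\<Delta>tbar}. \<forall>\<Delta>x\<in>sizes. \<forall>k<num_steps P \<Delta>t. \<forall>i\<in>indices (mesh \<Delta>x).
         (let m = mesh \<Delta>x; x = vert m i in
          \<bar>(scheme P m \<Delta>t k i (restrict \<phi> (vertices m)) - \<phi> x) -
            (- (SUP (a, b)\<in>ctrlA P \<times> ctrlB P.
                 \<Delta>t * Hop P (tm \<Delta>t k) x (D\<phi> x) (D2\<phi> x) a
                 + 1 / (2 * real CARD('s)) *
                     (\<Sum>s\<in>UNIV. dtil P m \<Delta>t k i s a b *
                        (Ltil P m \<Delta>t k i s (D\<phi> x) a b - sqrt \<Delta>t * K \<Delta>t \<Delta>x k i s a b))))\<bar>
          \<le> C * (\<Delta>t * sqrt \<Delta>t + \<Delta>x\<^sup>2))"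
    proof (intro exI[of _ C] ballI allI impI)
      fix \<Delta>t \<Delta>x k i
      assume *: "\<Delta>t \<in> {0<..\<Delta>tbar}" "\<Delta>x \<in> sizes" "k < num_steps P \<Delta>t" "i \<in> indices (mesh \<Delta>x)"
      let ?I = "ctrlA P \<times> ctrlB P"
      let ?f = "\<lambda>p. scheme_ab P (mesh \<Delta>x) \<Delta>t k i (restrict \<phi> (vertices (mesh \<Delta>x))) (fst p) (snd p)"
      let ?X = "\<lambda>p. X \<Delta>t \<Delta>x k i (fst p) (snd p)"
      obtain bX where bX: "\<And>p. p \<in> ?I \<Longrightarrow> \<bar>?X p\<bar> \<le> bX" using Xbound[OF *] by blast
      have "\<bar>(INF p\<in>?I. ?f p) - \<phi> (vert (mesh \<Delta>x) i) + (SUP p\<in>?I. ?X p)\<bar> \<le> C * (\<Delta>t * sqrt \<Delta>t + \<Delta>x\<^sup>2)"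
        by (rule INF_plus_SUP_error[OF _ _ bX]) (use AB main[OF *] in auto)
      moreover have eq: "p - (- q) = p + q" for p q :: real by simp
      ultimately show "let m = mesh \<Delta>x; x = vert m i in
          \<bar>(scheme P m \<Delta>t k i (restrict \<phi> (vertices m)) - \<phi> x) -
            (- (SUP (a, b)\<in>ctrlA P \<times> ctrlB P.
                 \<Delta>t * Hop P (tm \<Delta>t k) x (D\<phi> x) (D2\<phi> x) a
                 + 1 / (2 * real CARD('s)) *
                     (\<Sum>s\<in>UNIV. dtil P m \<Delta>t k i s a b *
                        (Ltil P m \<Delta>t k i s (D\<phi> x) a b - sqrt \<Delta>t * K \<Delta>t \<Delta>x k i s a b))))\<bar>
          \<le> C * (\<Delta>t * sqrt \<Delta>t + \<Delta>x\<^sup>2)"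
        unfolding scheme_def X_def Let_def eq case_prod_beta by blast
    qed
  qed
qed

end
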